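(* Let $a, w_1, w_2 > 0$ and $\bm{w}=(w_1,w_2)$. Then: (1) $\zeta_2(\sigma,\bm{w},a)$ has a zero $\sigma$ in the open interval $(1,2)$ if and only if $0<a<(w_1+w_2)/2$. (2) When $0<a<(w_1+w_2)/2$, $\zeta_2(\sigma,\bm{w},a)$ has precisely one zero in $(1,2)$, and this zero is simple.
   Context: For $a,w_1,w_2>0$ and $\bm{w}=(w_1,w_2)$, the Barnes double zeta function is $\zeta_2(s,\bm{w},a)=\sum_{m_1=0}^\infty\sum_{m_2=0}^\infty (a+m_1w_1+m_2w_2)^{-s}$ for $\Re(s)>2$. It extends meromorphically to $\mathbb{C}$ with simple poles at $s=1,2$; $\zeta_2(\sigma,\bm{w},a)$ for real $\sigma\in(1,2)$ refers to this continuation. *)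

theory Defs
  imports "HOL-Complex_Analysis.Complex_Analysis"
begin

definition barnes_zeta2_series :: "real \<Rightarrow> real \<Rightarrow> real \<Rightarrow> complex \<Rightarrow> complex" where
  "barnes_zeta2_series w1 w2 a s =
     (\<Sum>m1. \<Sum>m2. complex_of_real (a + real m1 * w1 + real m2 * w2) powr (- s))"

text \<open>
  The meromorphic continuation of the series. Among all functions that are meromorphic on the
  plane and extend the series, \<open>nicely_meromorphic_on\<close> selects the one with removable
  singularities removed and the value \<open>0\<close> at the poles, so that it is determined at every point.
  The only possible poles are \<open>s = 1\<close> and \<open>s = 2\<close>, so this convention is not visible for \<open>1 < s < 2\<close>.
\<close>
definition barnes_zeta2 :: "real \<Rightarrow> real \<Rightarrow> real \<Rightarrow> complex \<Rightarrow> complex" where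
  "barnes_zeta2 w1 w2 a =
     (THE f. f nicely_meromorphic_on UNIV \<and>
             (\<forall>s. Re s > 2 \<longrightarrow> f s = barnes_zeta2_series w1 w2 a s))"

end

theory Submission
  imports Defs "HOL-Real_Asymp.Real_Asymp"
begin

text \<open>
  For \<open>Re s > 2\<close>, \<open>\<Gamma>(s) \<zeta>\<^sub>2(s)\<close> is the Mellin transform of
  \<open>G(x) = e\<^bsup>-ax\<^esup> / ((1 - e\<^bsup>-w1 x\<^esup>) (1 - e\<^bsup>-w2 x\<^esup>))\<close>, and \<open>P(x) = x\<^sup>2 G(x)\<close> is analytic at \<open>0\<close>.
  Subtracting Taylor polynomials of \<open>P\<close> on \<open>(0,1)\<close> continues the transform to the whole plane, and for
  \<open>1 < Re s < 2\<close> this gives \<open>\<Gamma>(s) \<zeta>\<^sub>2(s) = \<integral> x\<^bsup>s-3\<^esup> (P(x) - P(0)) dx\<close> over \<open>(0,\<infinity>)\<close>.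

  Now \<open>P(x) / P(0) = exp (x M(x))\<close>, where \<open>M\<close> decreases strictly from \<open>(w1 + w2)/2 - a\<close> to \<open>-a\<close>, because
  \<open>ln (sinh y / y) / y\<close> increases strictly from \<open>0\<close> to \<open>1\<close>. If \<open>a \<ge> (w1 + w2)/2\<close>, the integrand is
  negative and there is no zero. Otherwise \<open>P - P(0)\<close> changes sign exactly once, from plus to minus, at
  some \<open>x0\<close>; hence \<open>x0\<^bsup>-s\<^esup> \<integral> x\<^bsup>s-3\<^esup> (P(x) - P(0)) dx\<close> has negative derivative in \<open>s\<close>, which yields
  uniqueness and simplicity of the zero. It exists because the residues of \<open>\<Gamma>(s) \<zeta>\<^sub>2(s)\<close> at \<open>1\<close>
  and \<open>2\<close> are both positive, which forces opposite signs at the two ends of the interval.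
\<close>

section \<open>Mellin transforms\<close>

abbreviation pos_lborel :: "real measure" where
  "pos_lborel \<equiv> restrict_space lborel {0<..}"

definition mellin :: "(real \<Rightarrow> real) \<Rightarrow> complex \<Rightarrow> complex" where
  "mellin h s = (\<integral>x. complex_of_real x powr (s - 1) * of_real (h x) \<partial>pos_lborel)"

text \<open>This is absolute convergence of the transform on the whole vertical line Re s =
  \<open>u\<close>: the modulus of \<open>x powr (s - 1)\<close> depends only on Re s, so a real
  exponent suffices.\<close>

definition mellin_convergent :: "(real \<Rightarrow> real) \<Rightarrow> real \<Rightarrow> bool" where
  "mellin_convergent h u \<longleftrightarrow> integrable pos_lborel (\<lambda>x. x powr (u - 1) * h x)"

lemma space_pos_lborel [simp]: "space pos_lborel = {0<..}"
  by (simp add: space_restrict_space)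

lemma borel_measurable_pos_lborel [measurable (raw)]:
  "f \<in> borel_measurable borel \<Longrightarrow> f \<in> borel_measurable pos_lborel"
  by (simp add: measurable_restrict_space1)

lemma AE_pos_lborelI: "(\<And>x. x > 0 \<Longrightarrow> Q x) \<Longrightarrow> AE x in pos_lborel. Q x"
  by (rule AE_I2) simp

text \<open>Integrability already contains measurability of the weighted function, and the weight is
  undone by the reciprocal power; \<open>h\<close> therefore needs no separate measurability
  hypothesis later.\<close>

lemma mellin_convergent_measurable:
  assumes "mellin_convergent h u"
  shows "h \<in> borel_measurable pos_lborel"
proof -
  have [measurable]: "(\<lambda>x. x powr (u - 1) * h x) \<in> borel_measurable pos_lborel"
    using assms unfolding mellin_convergent_def by auto
  have "(\<lambda>x. x powr (1 - u) * (x powr (u - 1) * h x)) \<in> borel_measurable pos_lborel"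
    by measurable
  also have "?this \<longleftrightarrow> ?thesis"
    by (rule measurable_cong) (simp flip: mult.assoc powr_add)
  finally show ?thesis .
qed

lemma of_real_powr_measurable [measurable]:
  "(\<lambda>x. complex_of_real x powr z) \<in> borel_measurable pos_lborel"
proof -
  have "(\<lambda>x. exp (z * complex_of_real (ln x))) \<in> borel_measurable pos_lborel"
    by measurable
  also have "?this \<longleftrightarrow> ?thesis"
    by (rule measurable_cong) (simp add: powr_def Ln_of_real)
  finally show ?thesis .
qed

lemma mellin_integrable:
  assumes "mellin_convergent h (Re s)"
  shows "integrable pos_lborel (\<lambda>x. complex_of_real x powr (s - 1) * of_real (h x))"
proof (rule Bochner_Integration.integrable_bound)
  note [measurable] = mellin_convergent_measurable[OF assms]
  show "integrable pos_lborel (\<lambda>x. x powr (Re s - 1) * h x)"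
    using assms by (simp add: mellin_convergent_def)
  show "(\<lambda>x. complex_of_real x powr (s - 1) * of_real (h x)) \<in> borel_measurable pos_lborel"
    by measurable
  show "AE x in pos_lborel. cmod (complex_of_real x powr (s - 1) * of_real (h x))
          \<le> norm (x powr (Re s - 1) * h x)"
    by (rule AE_pos_lborelI) (simp add: norm_mult norm_powr_real_powr abs_mult)
qed

lemma mellin_convergent_bound:
  assumes "mellin_convergent g u" "h \<in> borel_measurable pos_lborel"
    and "\<And>x. x > 0 \<Longrightarrow> \<bar>h x\<bar> \<le> \<bar>g x\<bar>"
  shows "mellin_convergent h u"
  unfolding mellin_convergent_def
proof (rule Bochner_Integration.integrable_bound)
  note [measurable] = assms(2)
  show "integrable pos_lborel (\<lambda>x. x powr (u - 1) * g x)"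
    using assms(1) by (simp add: mellin_convergent_def)
  show "(\<lambda>x. x powr (u - 1) * h x) \<in> borel_measurable pos_lborel"
    by measurable
  show "AE x in pos_lborel. norm (x powr (u - 1) * h x) \<le> norm (x powr (u - 1) * g x)"
    by (rule AE_pos_lborelI) (use assms(3) in \<open>auto simp: abs_mult intro: mult_left_mono\<close>)
qed

lemma mellin_convergent_add:
  "mellin_convergent f u \<Longrightarrow> mellin_convergent g u \<Longrightarrow> mellin_convergent (\<lambda>x. f x + g x) u"
  by (simp add: mellin_convergent_def distrib_left)

lemma mellin_convergent_diff:
  "mellin_convergent f u \<Longrightarrow> mellin_convergent g u \<Longrightarrow> mellin_convergent (\<lambda>x. f x - g x) u"
  by (simp add: mellin_convergent_def right_diff_distrib)

lemma mellin_convergent_cmult: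
  "mellin_convergent f u \<Longrightarrow> mellin_convergent (\<lambda>x. c * f x) u"
  by (simp add: mellin_convergent_def mult.left_commute)

lemma mellin_convergent_cong:
  "(\<And>x. x > 0 \<Longrightarrow> f x = g x) \<Longrightarrow> mellin_convergent f u \<longleftrightarrow> mellin_convergent g u"
  unfolding mellin_convergent_def by (intro Bochner_Integration.integrable_cong) auto

lemma mellin_convergent_shift:
  "mellin_convergent (\<lambda>x. x powr v * h x) u \<longleftrightarrow> mellin_convergent h (u + v)"
  unfolding mellin_convergent_def
proof (intro Bochner_Integration.integrable_cong refl)
  fix x assume "x \<in> space pos_lborel"
  have "x powr (u + v - 1) = x powr (u - 1) * x powr v"
    by (subst powr_add [symmetric]) (simp add: algebra_simps)
  thus "x powr (u - 1) * (x powr v * h x) = x powr (u + v - 1) * h x"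
    by simp
qed

lemma mellin_diff:
  assumes "mellin_convergent f (Re s)" "mellin_convergent g (Re s)"
  shows "mellin (\<lambda>x. f x - g x) s = mellin f s - mellin g s"
  using assms[THEN mellin_integrable] unfolding mellin_def
  by (simp add: right_diff_distrib)

lemma mellin_cmult: "mellin (\<lambda>x. c * f x) s = of_real c * mellin f s"
  unfolding mellin_def by (simp add: mult.left_commute)

lemma mellin_cong: "(\<And>x. x > 0 \<Longrightarrow> f x = g x) \<Longrightarrow> mellin f s = mellin g s"
  unfolding mellin_def by (intro Bochner_Integration.integral_cong) auto

lemma mellin_shift:
  "mellin (\<lambda>x. x powr v * h x) s = mellin h (s + of_real v)"
  unfolding mellin_def
proof (intro Bochner_Integration.integral_cong refl)
  fix x assume x: "x \<in> space pos_lborel"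
  have "complex_of_real x powr (s + of_real v - 1) = of_real x powr (s - 1) * of_real x powr of_real v"
    by (subst powr_add [symmetric]) (simp add: algebra_simps)
  thus "complex_of_real x powr (s - 1) * of_real (x powr v * h x) = of_real x powr (s + of_real v - 1) * of_real (h x)"
    using x by (simp flip: powr_of_real)
qed

lemma mellin_of_real:
  "mellin h (of_real u) = of_real (\<integral>x. x powr (u - 1) * h x \<partial>pos_lborel)"
proof -
  have "mellin h (of_real u) = (\<integral>x. complex_of_real (x powr (u - 1) * h x) \<partial>pos_lborel)"
    unfolding mellin_def
    by (intro Bochner_Integration.integral_cong)
       (auto simp flip: powr_of_real)
  also have "\<dots> = of_real (\<integral>x. x powr (u - 1) * h x \<partial>pos_lborel)"
    by (rule integral_complex_of_real)
  finally show ?thesis .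
qed

section \<open>Differentiation under the Mellin integral\<close>

lemma abs_ln_le_powr:
  fixes x e :: real
  assumes "x > 0" "e > 0"
  shows "\<bar>ln x\<bar> \<le> (x powr e + x powr (-e)) / e"
proof -
  \<comment> \<open>Both estimates are ln y <= y - 1, taken at y = \<open>x powr e\<close> and at y
    = \<open>x powr (-e)\<close>. A logarithm thus costs an arbitrarily small change of
    exponent.\<close>
  have "e * ln x \<le> x powr e"
    using ln_le_minus_one[of "x powr e"] assms by (simp add: ln_powr)
  moreover have "- e * ln x \<le> x powr (- e)"
    using ln_le_minus_one[of "x powr (- e)"] assms by (simp add: ln_powr)
  moreover have "x powr e > 0" "x powr (-e) > 0" using assms by auto
  ultimately have "e * \<bar>ln x\<bar> \<le> x powr e + x powr (-e)"
    by (cases "ln x \<ge> 0") linarith+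
  thus ?thesis using assms by (simp add: field_simps)
qed

text \<open>Mean value inequality for \<open>exp\<close> on the disc of radius
  \<open>cmod z\<close>, where the derivative is at most \<open>exp (cmod z)\<close>.\<close>

lemma norm_exp_minus_1_le: "cmod (exp z - 1) \<le> cmod z * exp (cmod z)"
proof -
  have "cmod (exp z - exp 0) \<le> exp (cmod z) * cmod (z - 0)"
  proof (rule field_differentiable_bound)
    show "convex (cball 0 (cmod z) :: complex set)" by simp
    show "(exp has_field_derivative exp w) (at w within cball 0 (cmod z))" for w
      by (auto intro!: derivative_eq_intros)
    show "cmod (exp w) \<le> exp (cmod z)" if "w \<in> cball 0 (cmod z)" for w
      using that norm_exp[of w] by (smt (verit) exp_le_cancel_iff mem_cball_0)
  qed auto
  thus ?thesis by (simp add: mult.commute)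
qed

text \<open>The bound is uniform in \<open>k\<close>, as a majorant for difference quotients must
  be. \<open>exp (e * \<bar>ln x\<bar>)\<close> equals one of the two powers, depending on the side
  of 1 on which \<open>x\<close> lies, so their sum covers both cases.\<close>

lemma norm_powr_diff_quotient_le:
  fixes x e :: real and k :: complex
  assumes "x > 0" "cmod k \<le> e"
  shows "cmod ((complex_of_real x powr k - 1) / k) \<le> \<bar>ln x\<bar> * (x powr e + x powr (-e))"
proof (cases "k = 0")
  case False
  have e: "e \<ge> 0" using assms norm_ge_zero[of k] by linarith
  have "complex_of_real x powr k = exp (k * of_real (ln x))"
    using assms by (simp add: powr_def Ln_of_real)
  moreover have "cmod (exp (k * of_real (ln x)) - 1) \<le> cmod (k * of_real (ln x)) * exp (cmod (k * of_real (ln x)))"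
    by (rule norm_exp_minus_1_le)
  moreover have "exp (cmod (k * of_real (ln x))) \<le> exp (e * \<bar>ln x\<bar>)"
    using assms by (auto simp: norm_mult intro: mult_right_mono)
  moreover have "exp (e * \<bar>ln x\<bar>) = x powr e \<or> exp (e * \<bar>ln x\<bar>) = x powr (-e)"
    using assms(1) by (cases "ln x \<ge> 0") (simp_all add: powr_def)
  hence "exp (e * \<bar>ln x\<bar>) \<le> x powr e + x powr (-e)"
    using powr_ge_zero[of x e] powr_ge_zero[of x "-e"] by linarith
  ultimately have "cmod (complex_of_real x powr k - 1) \<le> cmod (k * of_real (ln x)) * (x powr e + x powr (-e))"
    by (smt (verit) mult_left_mono norm_ge_zero)
  thus ?thesis using False by (simp add: norm_divide norm_mult field_simps)
qed auto

text \<open>The factor 2 leaves room for two losses of \<open>e\<close> in the exponent: one from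
  the logarithm, one from the increment of \<open>s\<close>.\<close>

lemma open_real_obtain_radius:
  fixes u :: real
  assumes "open S" "u \<in> S"
  obtains e where "e > 0" "u - 2 * e \<in> S" "u + 2 * e \<in> S"
proof -
  obtain d where d: "d > 0" "ball u d \<subseteq> S"
    using assms by (meson openE)
  have "u - 2 * (d / 4) \<in> ball u d" "u + 2 * (d / 4) \<in> ball u d"
    using d(1) by (auto simp: dist_real_def)
  hence "u - 2 * (d / 4) \<in> S" "u + 2 * (d / 4) \<in> S"
    using d(2) by blast+
  thus ?thesis using that[of "d / 4"] d assms by auto
qed

text \<open>Expanding the square produces the exponents \<open>2 * e\<close>, 0 and
  \<open>- (2 * e)\<close>, one for each convergence hypothesis.\<close>

lemma mellin_convergent_powr_bound:
  assumes "mellin_convergent h u" "mellin_convergent h (u - 2 * e)" "mellin_convergent h (u + 2 * e)"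
  shows "mellin_convergent (\<lambda>x. (x powr e + x powr (-e))\<^sup>2 * h x) u"
proof -
  have 1: "mellin_convergent (\<lambda>x. x powr (2 * e) * h x) u"
    using assms(3) mellin_convergent_shift[of "2 * e" h u] by (simp only:)
  have 2: "mellin_convergent (\<lambda>x. x powr (- (2 * e)) * h x) u"
    using assms(2) mellin_convergent_shift[of "- (2 * e)" h u] by (simp only: diff_conv_add_uminus)
  have "mellin_convergent (\<lambda>x. (x powr (2 * e) * h x + 2 * h x) + x powr (- (2 * e)) * h x) u"
    by (rule mellin_convergent_add[OF mellin_convergent_add[OF 1 mellin_convergent_cmult[OF assms(1)]] 2])
  also have "?this \<longleftrightarrow> ?thesis"
  proof (rule mellin_convergent_cong)
    fix x :: real assume x: "x > 0"
    have "x powr (2 * e) = x powr e * x powr e" "x powr (- (2 * e)) = x powr (-e) * x powr (-e)"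
      by (simp_all flip: powr_add)
    moreover have "x powr e * x powr (-e) = 1"
      using x by (simp flip: powr_add)
    ultimately show "(x powr (2 * e) * h x + 2 * h x) + x powr (- (2 * e)) * h x
        = (x powr e + x powr (-e))\<^sup>2 * h x"
      by algebra
  qed
  finally show ?thesis .
qed

lemma mellin_convergent_ln:
  assumes "open S" "\<And>u. u \<in> S \<Longrightarrow> mellin_convergent h u" "u \<in> S"
  shows "mellin_convergent (\<lambda>x. ln x * h x) u"
proof -
  obtain e where e: "e > 0" "u - 2 * e \<in> S" "u + 2 * e \<in> S"
    using open_real_obtain_radius[OF assms(1,3)] .
  note [measurable] = mellin_convergent_measurable[OF assms(2)[OF assms(3)]]
  have "mellin_convergent (\<lambda>x. (1 / e) * ((x powr e + x powr (-e))\<^sup>2 * h x)) u"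
    by (rule mellin_convergent_cmult, rule mellin_convergent_powr_bound; rule assms(2)) fact+
  thus ?thesis
  proof (rule mellin_convergent_bound)
    show "(\<lambda>x. ln x * h x) \<in> borel_measurable pos_lborel" by measurable
    fix x :: real assume x: "x > 0"
    \<comment> \<open>One of the two powers is at least 1, so their sum is at most its square. This
      allows the majorant with the squared sum to be reused here.\<close>
    have "1 \<le> x powr e \<or> 1 \<le> x powr (-e)"
    proof (cases "x \<ge> 1")
      case True
      thus ?thesis using e(1) by (intro disjI1 ge_one_powr_ge_zero) auto
    next
      case False
      hence "1 powr (-e) \<le> x powr (-e)" using x e(1) by (intro powr_mono2') auto
      thus ?thesis by simp
    qed
    hence 1: "1 \<le> x powr e + x powr (-e)"
      using powr_ge_zero[of x e] powr_ge_zero[of x "-e"] by linarith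
    have "\<bar>ln x\<bar> \<le> (x powr e + x powr (-e)) / e"
      using abs_ln_le_powr x e by blast
    also have "\<dots> \<le> (x powr e + x powr (-e))\<^sup>2 / e"
      using 1 e by (intro divide_right_mono self_le_power) auto
    finally have "\<bar>ln x\<bar> * \<bar>h x\<bar> \<le> (x powr e + x powr (-e))\<^sup>2 / e * \<bar>h x\<bar>"
      by (rule mult_right_mono) auto
    thus "\<bar>ln x * h x\<bar> \<le> \<bar>(1 / e) * ((x powr e + x powr (-e))\<^sup>2 * h x)\<bar>"
      using e(1) by (simp add: abs_mult)
  qed
qed

text \<open>Dominated convergence along an arbitrary null sequence of increments. The majorant is
  the integrand of \<open>mellin_convergent_powr_bound\<close> divided by \<open>e\<close>: one
  factor of the square bounds \<open>ln x\<close>, the other bounds the power of the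
  increment.\<close>

lemma mellin_has_field_derivative:
  assumes S: "open S" "\<And>u. u \<in> S \<Longrightarrow> mellin_convergent h u" and s: "Re s \<in> S"
  shows "(mellin h has_field_derivative mellin (\<lambda>x. ln x * h x) s) (at s)"
  unfolding DERIV_def tendsto_at_iff_sequentially
proof (intro allI impI)
  fix X :: "nat \<Rightarrow> complex"
  assume X0: "\<forall>i. X i \<in> UNIV - {0}" and Xlim: "X \<longlonglongrightarrow> 0"
  obtain e where e: "e > 0" "Re s - 2 * e \<in> S" "Re s + 2 * e \<in> S"
    using open_real_obtain_radius[OF S(1) s] .
  obtain d where d: "d > 0" "ball (Re s) d \<subseteq> S"
    using S(1) s by (meson openE)
  have "eventually (\<lambda>n. cmod (X n) < min d e) sequentially"
    using tendsto_norm[OF Xlim] d(1) e(1) by (intro order_tendstoD) auto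
  then obtain N where N: "\<And>n. n \<ge> N \<Longrightarrow> cmod (X n) < min d e"
    by (auto simp: eventually_at_top_linorder)
  \<comment> \<open>Dropping the first \<open>N\<close> terms makes every increment small enough for
    the bounds; \<open>LIMSEQ_offset\<close> restores the full sequence at the end.\<close>
  define Y where "Y n = X (n + N)" for n
  have Y: "cmod (Y n) < d" "cmod (Y n) \<le> e" "Y n \<noteq> 0" for n
    using N[of "n + N"] X0 by (auto simp: Y_def)
  have Ylim: "Y \<longlonglongrightarrow> 0"
    unfolding Y_def using Xlim by (rule LIMSEQ_ignore_initial_segment)
  have cs: "mellin_convergent h (Re s)" using S s by auto
  have csY: "mellin_convergent h (Re (s + Y n))" for n
  proof -
    have "\<bar>Re (Y n)\<bar> < d" using abs_Re_le_cmod[of "Y n"] Y[of n] by linarith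
    hence "Re (s + Y n) \<in> ball (Re s) d" by (auto simp: dist_real_def)
    thus ?thesis using S d by blast
  qed
  define q where "q n x = complex_of_real x powr (s - 1) * of_real (h x) *
                    ((complex_of_real x powr Y n - 1) / Y n)" for n x
  note [measurable] = mellin_convergent_measurable[OF cs]
  have q_eq: "(mellin h (s + Y n) - mellin h s) / Y n = (\<integral>x. q n x \<partial>pos_lborel)" for n
  proof -
    have "mellin h (s + Y n) - mellin h s =
      (\<integral>x. complex_of_real x powr (s + Y n - 1) * of_real (h x) - complex_of_real x powr (s - 1) * of_real (h x) \<partial>pos_lborel)"
      unfolding mellin_def using mellin_integrable[OF cs] mellin_integrable[OF csY[of n]]
      by simp
    also have "\<dots> = (\<integral>x. Y n * q n x \<partial>pos_lborel)"
    proof (intro Bochner_Integration.integral_cong refl)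
      fix x :: real
      have "complex_of_real x powr (s + Y n - 1) = of_real x powr (s - 1) * of_real x powr Y n"
        by (subst powr_add [symmetric]) (simp add: algebra_simps)
      moreover have "Y n * q n x = of_real x powr (s - 1) * of_real (h x) * (of_real x powr Y n - 1)"
        using Y(3)[of n] by (simp add: q_def)
      ultimately show "complex_of_real x powr (s + Y n - 1) * of_real (h x) - complex_of_real x powr (s - 1) * of_real (h x) = Y n * q n x"
        by (simp add: right_diff_distrib)
    qed
    finally show ?thesis using Y(3)[of n] by simp
  qed
  have "(\<lambda>n. \<integral>x. q n x \<partial>pos_lborel) \<longlonglongrightarrow> (\<integral>x. complex_of_real x powr (s - 1) * of_real (ln x * h x) \<partial>pos_lborel)"
  proof (rule integral_dominated_convergence)
    have "mellin_convergent (\<lambda>x. (x powr e + x powr (-e))\<^sup>2 * h x) (Re s)"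
      by (rule mellin_convergent_powr_bound; rule S(2)) fact+
    hence "mellin_convergent (\<lambda>x. (1/e) * ((x powr e + x powr (-e))\<^sup>2 * h x)) (Re s)"
      by (rule mellin_convergent_cmult)
    thus "integrable pos_lborel (\<lambda>x. \<bar>x powr (Re s - 1) * ((1/e) * ((x powr e + x powr (-e))\<^sup>2 * h x))\<bar>)"
      unfolding mellin_convergent_def by (rule integrable_abs)
    show "(\<lambda>x. complex_of_real x powr (s - 1) * complex_of_real (ln x * h x)) \<in> borel_measurable pos_lborel"
      by measurable
    show "q n \<in> borel_measurable pos_lborel" for n
      unfolding q_def by measurable
    show "AE x in pos_lborel. (\<lambda>i. q i x) \<longlonglongrightarrow> complex_of_real x powr (s - 1) * complex_of_real (ln x * h x)"
    proof (rule AE_pos_lborelI)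
      fix x :: real assume x: "x > 0"
      have "((\<lambda>k. complex_of_real x powr k) has_field_derivative of_real (ln x)) (at 0)"
        using x by (auto intro!: derivative_eq_intros simp: Ln_of_real)
      hence "((\<lambda>k. (complex_of_real x powr k - 1) / k) \<longlongrightarrow> of_real (ln x)) (at 0)"
        using x by (simp add: DERIV_def)
      hence "(\<lambda>n. (complex_of_real x powr Y n - 1) / Y n) \<longlonglongrightarrow> of_real (ln x)"
        unfolding tendsto_at_iff_sequentially using Y(3) Ylim by (auto simp: o_def)
      hence "(\<lambda>n. q n x) \<longlonglongrightarrow> complex_of_real x powr (s - 1) * of_real (h x) * of_real (ln x)"
        unfolding q_def by (intro tendsto_intros)
      thus "(\<lambda>i. q i x) \<longlonglongrightarrow> complex_of_real x powr (s - 1) * complex_of_real (ln x * h x)"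
        by (simp add: mult_ac)
    qed
    show "AE x in pos_lborel. norm (q n x) \<le> \<bar>x powr (Re s - 1) * ((1/e) * ((x powr e + x powr (-e))\<^sup>2 * h x))\<bar>" for n
    proof (rule AE_pos_lborelI)
      fix x :: real assume x: "x > 0"
      have "norm (q n x) = x powr (Re s - 1) * \<bar>h x\<bar> * cmod ((complex_of_real x powr Y n - 1) / Y n)"
        using x by (simp add: q_def norm_mult norm_divide norm_powr_real_powr)
      also have "\<dots> \<le> x powr (Re s - 1) * \<bar>h x\<bar> * ((x powr e + x powr (-e)) / e * (x powr e + x powr (-e)))"
        using order.trans[OF norm_powr_diff_quotient_le[OF x Y(2)] mult_right_mono[OF abs_ln_le_powr[OF x e(1)]]]
        by (intro mult_left_mono) auto
      also have "\<dots> = \<bar>x powr (Re s - 1) * ((1/e) * ((x powr e + x powr (-e))\<^sup>2 * h x))\<bar>"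
        using e(1) by (simp add: abs_mult power2_eq_square)
      finally show "norm (q n x) \<le> \<bar>x powr (Re s - 1) * ((1/e) * ((x powr e + x powr (-e))\<^sup>2 * h x))\<bar>" .
    qed
  qed
  hence "(\<lambda>n. (mellin h (s + Y n) - mellin h s) / Y n) \<longlonglongrightarrow> mellin (\<lambda>x. ln x * h x) s"
    unfolding q_eq unfolding mellin_def .
  hence "(\<lambda>n. (mellin h (s + X n) - mellin h s) / X n) \<longlonglongrightarrow> mellin (\<lambda>x. ln x * h x) s"
    unfolding Y_def by (rule LIMSEQ_offset)
  thus "((\<lambda>k. (mellin h (s + k) - mellin h s) / k) \<circ> X) \<longlonglongrightarrow> mellin (\<lambda>x. ln x * h x) s"
    by (simp add: o_def)
qed

lemma mellin_holomorphic:
  assumes "open S" "\<And>u. u \<in> S \<Longrightarrow> mellin_convergent h u"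
  shows "mellin h holomorphic_on {s. Re s \<in> S}"
proof -
  have "open {s. Re s \<in> S}"
    using open_vimage[OF assms(1) continuous_on_Re[OF continuous_on_id]] by (simp add: vimage_def)
  thus ?thesis
    using mellin_has_field_derivative[OF assms] by (auto simp: holomorphic_on_open)
qed

section \<open>Mellin transforms of the indicators of (0,1) and [1,infinity)\<close>

lemma set_integral_pos_lborel:
  fixes f :: "real \<Rightarrow> 'a::{banach, second_countable_topology}"
  assumes "A \<subseteq> {0<..}" "A \<in> sets borel"
  shows "(\<integral>x. indicator A x *\<^sub>R f x \<partial>pos_lborel) = (LINT x:A|lborel. f x)"
    and "integrable pos_lborel (\<lambda>x. indicator A x *\<^sub>R f x) \<longleftrightarrow> set_integrable lborel A f"
proof -
  have *: "indicat_real {0<..} x * indicator A x = indicator A x" for x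
    using assms(1) by (auto simp: indicator_def)
  show "(\<integral>x. indicator A x *\<^sub>R f x \<partial>pos_lborel) = (LINT x:A|lborel. f x)"
    by (simp add: integral_restrict_space set_lebesgue_integral_def *)
  show "integrable pos_lborel (\<lambda>x. indicator A x *\<^sub>R f x) \<longleftrightarrow> set_integrable lborel A f"
    by (simp add: integrable_restrict_space set_integrable_def *)
qed

lemma greaterThanLessThan_subset_greaterThan: "{a<..<b} \<subseteq> {a<..}" for a b :: real
  by auto

lemma mellin_convergent_indicator_iff:
  assumes "A \<subseteq> {0<..}" "A \<in> sets borel"
  shows "mellin_convergent (indicator A) u \<longleftrightarrow> set_integrable lborel A (\<lambda>x. x powr (u - 1))"
  using set_integral_pos_lborel(2)[OF assms, of "\<lambda>x. x powr (u - 1)"]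
  by (simp add: mellin_convergent_def mult.commute)

lemma mellin_indicator:
  assumes "A \<subseteq> {0<..}" "A \<in> sets borel"
  shows "mellin (indicator A) s = (LINT x:A|lborel. complex_of_real x powr (s - 1))"
proof -
  have "mellin (indicator A) s = (\<integral>x. indicator A x *\<^sub>R complex_of_real x powr (s - 1) \<partial>pos_lborel)"
    unfolding mellin_def by (intro Bochner_Integration.integral_cong) (auto simp: indicator_def)
  thus ?thesis using set_integral_pos_lborel(1)[OF assms] by simp
qed

text \<open>For nonnegative functions gauge integrability is absolute integrability, and Borel
  measurability allows the descent from the completed measure to \<open>lborel\<close>.\<close>

lemma set_integrable_lborelI_nonneg:
  fixes f :: "real \<Rightarrow> real"
  assumes "f integrable_on A" "\<And>x. x \<in> A \<Longrightarrow> f x \<ge> 0" "f \<in> borel_measurable borel" "A \<in> sets borel"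
  shows "set_integrable lborel A f"
proof -
  have "f absolutely_integrable_on A"
    using assms by (intro nonnegative_absolutely_integrable_1)
  hence "integrable lebesgue (\<lambda>x. indicator A x *\<^sub>R f x)"
    by (simp add: set_integrable_def)
  thus ?thesis unfolding set_integrable_def
    using assms by (subst (asm) integrable_completion) auto
qed

lemma of_real_powr_has_vector_derivative:
  assumes "x > 0" "s \<noteq> 0"
  shows "((\<lambda>x. complex_of_real x powr s / s) has_vector_derivative complex_of_real x powr (s - 1)) (at x)"
proof -
  have "((\<lambda>z. z powr s / s) has_field_derivative complex_of_real x powr (s - 1)) (at (of_real x))"
    using assms by (auto intro!: derivative_eq_intros)
  thus ?thesis by (rule has_vector_derivative_real_field)
qed

lemma mellin_convergent_unit_interval:
  assumes "u > 0"
  shows "mellin_convergent (indicator {0<..<1}) u"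
proof -
  have "(\<lambda>x. x powr (u - 1)) integrable_on {0..1}"
    using has_integral_powr_from_0[of "u - 1" 1] assms by (auto simp: integrable_on_def)
  hence "(\<lambda>x. x powr (u - 1)) integrable_on {0<..<1}"
    by (simp add: integrable_on_Icc_iff_Ioo)
  thus ?thesis
    by (subst mellin_convergent_indicator_iff) (auto intro!: set_integrable_lborelI_nonneg)
qed

text \<open>Fundamental theorem of calculus with antiderivative \<open>x powr s / s\<close>, which
  tends to 0 at the origin because Re s > 0.\<close>

lemma mellin_unit_interval:
  assumes "Re s > 0"
  shows "mellin (indicator {0<..<1}) s = 1 / s"
proof -
  let ?F = "\<lambda>x. complex_of_real x powr s / s"
  have s: "s \<noteq> 0" using assms by auto
  have "(LBINT x=0..1. complex_of_real x powr (s - 1)) = 1 / s - 0"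
  proof (rule interval_integral_FTC_integrable)
    show "(?F has_vector_derivative complex_of_real x powr (s - 1)) (at x)"
      if "0 < ereal x" "ereal x < 1" for x
      using of_real_powr_has_vector_derivative[of x s] that s by simp
    show "isCont (\<lambda>x. complex_of_real x powr (s - 1)) x" if "0 < ereal x" "ereal x < 1" for x
      using that by (intro continuous_intros) auto
    have "integrable pos_lborel (\<lambda>x. complex_of_real x powr (s - 1) * of_real (indicator {0<..<1} x))"
      using mellin_integrable mellin_convergent_unit_interval assms by blast
    hence "integrable pos_lborel (\<lambda>x. indicator {0<..<1} x *\<^sub>R complex_of_real x powr (s - 1))"
      by (simp add: scaleR_conv_of_real mult.commute)
    thus "set_integrable lborel (einterval 0 1) (\<lambda>x. complex_of_real x powr (s - 1))"
      by (subst (asm) set_integral_pos_lborel) (auto simp: zero_ereal_def one_ereal_def einterval_eq_Icc)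
    have "((\<lambda>x. x powr Re s) \<longlongrightarrow> 0) (at_right 0)"
      using assms by real_asymp
    hence "((\<lambda>x. norm (complex_of_real x powr s)) \<longlongrightarrow> 0) (at_right 0)"
      by (rule Lim_transform_eventually)
         (auto simp: eventually_at_filter norm_powr_real_powr)
    hence "(?F \<longlongrightarrow> 0) (at_right 0)"
      by (rule tendsto_divide_zero[OF tendsto_norm_zero_cancel])
    thus "((?F \<circ> real_of_ereal) \<longlongrightarrow> 0) (at_right 0)"
      by (simp add: zero_ereal_def ereal_tendsto_simps)
    have "(?F \<longlongrightarrow> complex_of_real 1 powr s / s) (at_left 1)"
      using s by (intro tendsto_intros) auto
    thus "((?F \<circ> real_of_ereal) \<longlongrightarrow> 1 / s) (at_left 1)"
      by (simp add: one_ereal_def ereal_tendsto_simps)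
  qed auto
  thus ?thesis
    using mellin_indicator[OF greaterThanLessThan_subset_greaterThan, of 1 s]
    by (simp add: interval_lebesgue_integral_def zero_ereal_def one_ereal_def)
qed

lemma mellin_convergent_beyond_1:
  assumes "u < 0"
  shows "mellin_convergent (indicator {1..}) u"
proof -
  have "(\<lambda>x. x powr (u - 1)) integrable_on {1..}"
    using has_integral_powr_to_inf[of "u - 1" 1] assms by (auto simp: integrable_on_def)
  thus ?thesis
    by (subst mellin_convergent_indicator_iff) (auto intro!: set_integrable_lborelI_nonneg)
qed

text \<open>Up to sign this is the same rational function as for (0,1), but on the opposite
  half-plane. This is what later lets the constant term be subtracted on the whole
  half-line.\<close>

lemma mellin_beyond_1:
  assumes "Re s < 0"
  shows "mellin (indicator {1..}) s = - (1 / s)"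
proof -
  let ?F = "\<lambda>x. complex_of_real x powr s / s"
  have s: "s \<noteq> 0" using assms by auto
  have "(LBINT x=1..\<infinity>. complex_of_real x powr (s - 1)) = 0 - 1 / s"
  proof (rule interval_integral_FTC_integrable)
    show "(?F has_vector_derivative complex_of_real x powr (s - 1)) (at x)"
      if "1 < ereal x" "ereal x < \<infinity>" for x
      using of_real_powr_has_vector_derivative[of x s] that s by simp
    show "isCont (\<lambda>x. complex_of_real x powr (s - 1)) x" if "1 < ereal x" "ereal x < \<infinity>" for x
      using that by (intro continuous_intros) auto
    have "integrable pos_lborel (\<lambda>x. complex_of_real x powr (s - 1) * of_real (indicator {1..} x))"
      using mellin_integrable mellin_convergent_beyond_1 assms by blast
    hence "integrable pos_lborel (\<lambda>x. indicator {1..} x *\<^sub>R complex_of_real x powr (s - 1))"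
      by (simp add: scaleR_conv_of_real mult.commute)
    hence "set_integrable lborel {1..} (\<lambda>x. complex_of_real x powr (s - 1))"
      by (subst (asm) set_integral_pos_lborel) auto
    thus "set_integrable lborel (einterval 1 \<infinity>) (\<lambda>x. complex_of_real x powr (s - 1))"
      by (rule set_integrable_subset) (auto simp: one_ereal_def)
    have "((\<lambda>x. x powr Re s) \<longlongrightarrow> 0) at_top"
      using assms by real_asymp
    hence "((\<lambda>x. norm (complex_of_real x powr s)) \<longlongrightarrow> 0) at_top"
      by (rule Lim_transform_eventually)
         (auto intro: eventually_mono[OF eventually_gt_at_top[of 0]] simp: norm_powr_real_powr)
    hence "(?F \<longlongrightarrow> 0) at_top"
      by (rule tendsto_divide_zero[OF tendsto_norm_zero_cancel])
    thus "((?F \<circ> real_of_ereal) \<longlongrightarrow> 0) (at_left \<infinity>)"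
      by (simp add: ereal_tendsto_simps)
    have "(?F \<longlongrightarrow> complex_of_real 1 powr s / s) (at_right 1)"
      using s by (intro tendsto_intros) auto
    thus "((?F \<circ> real_of_ereal) \<longlongrightarrow> 1 / s) (at_right 1)"
      by (simp add: one_ereal_def ereal_tendsto_simps)
  qed auto
  also have "(LBINT x=1..\<infinity>. complex_of_real x powr (s - 1)) = (LINT x:{1<..}|lborel. complex_of_real x powr (s - 1))"
    by (simp add: interval_lebesgue_integral_def one_ereal_def)
  \<comment> \<open>The two intervals differ only in the null set {1}.\<close>
  also have "\<dots> = (LINT x:{1..}|lborel. complex_of_real x powr (s - 1))"
    unfolding set_lebesgue_integral_def
    by (intro integral_cong_AE AE_I[where N="{1}"]) (auto simp: indicator_def split: if_splits)
  finally have "(LINT x:{1..}|lborel. complex_of_real x powr (s - 1)) = - (1 / s)"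
    by simp
  moreover have "mellin (indicator {1..}) s = (LINT x:{1..}|lborel. complex_of_real x powr (s - 1))"
    by (rule mellin_indicator) auto
  ultimately show ?thesis by simp
qed

section \<open>Continuation of a Mellin transform\<close>

text \<open>
  The Taylor polynomial is removed on the unit interval only, so that the behaviour at infinity is
  not affected; its terms contribute the poles in \<open>mellin_cont\<close>.
\<close>
definition mellin_regular ::
    "(real \<Rightarrow> real) \<Rightarrow> (nat \<Rightarrow> real) \<Rightarrow> nat \<Rightarrow> real \<Rightarrow> real" where
  "mellin_regular P p N x = P x - (\<Sum>n<N. p n * (x ^ n * indicator {0<..<1} x))"

definition mellin_cont ::
    "(real \<Rightarrow> real) \<Rightarrow> (nat \<Rightarrow> real) \<Rightarrow> nat \<Rightarrow> complex \<Rightarrow> complex" where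
  "mellin_cont P p N s = (\<Sum>n<N. of_real (p n) / (s + of_nat n)) + mellin (mellin_regular P p N) s"

text \<open>Rapid decay at infinity and an asymptotic expansion at 0 to every order are all that the
  continuation requires; convergence of the series with coefficients \<open>p\<close> is not
  demanded.\<close>

locale mellin_continuation =
  fixes P :: "real \<Rightarrow> real" and p :: "nat \<Rightarrow> real"
  assumes tail: "\<And>u. mellin_convergent (\<lambda>x. indicator {1..} x * P x) u"
    and P_measurable: "P \<in> borel_measurable pos_lborel"
    and expansion: "\<And>N. \<exists>C. \<forall>x. 0 < x \<longrightarrow> x < 1 \<longrightarrow> \<bar>P x - (\<Sum>n<N. p n * x ^ n)\<bar> \<le> C * x ^ N"
begin

lemma convergent_monomial:
  assumes "u > - real n"
  shows "mellin_convergent (\<lambda>x. x ^ n * indicator {0<..<1} x) u"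
proof -
  have "mellin_convergent (\<lambda>x. x powr real n * indicator {0<..<1} x) u"
    using assms by (subst mellin_convergent_shift) (auto intro!: mellin_convergent_unit_interval)
  also have "?this \<longleftrightarrow> ?thesis"
    by (rule mellin_convergent_cong) (simp add: powr_realpow)
  finally show ?thesis .
qed

lemma mellin_monomial:
  assumes "Re s > - real n"
  shows "mellin (\<lambda>x. x ^ n * indicator {0<..<1} x) s = 1 / (s + of_nat n)"
proof -
  have "mellin (\<lambda>x. x ^ n * indicator {0<..<1} x) s = mellin (\<lambda>x. x powr real n * indicator {0<..<1} x) s"
    by (rule mellin_cong) (simp add: powr_realpow)
  also have "\<dots> = 1 / (s + of_nat n)"
    using assms by (subst mellin_shift) (simp add: mellin_unit_interval)
  finally show ?thesis .
qed

text \<open>On (0,1) the remainder is of order \<open>x ^ N\<close>, which is integrable against the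
  weight for \<open>u > - real N\<close>; beyond 1 only the tail of \<open>P\<close>
  remains.\<close>

lemma convergent_regular:
  assumes "u > - real N"
  shows "mellin_convergent (mellin_regular P p N) u"
proof -
  note [measurable] = P_measurable
  obtain C where C: "\<And>x. 0 < x \<Longrightarrow> x < 1 \<Longrightarrow> \<bar>P x - (\<Sum>n<N. p n * x ^ n)\<bar> \<le> C * x ^ N"
    using expansion[of N] by blast
  have "mellin_convergent (\<lambda>x. C * (x ^ N * indicator {0<..<1} x) + indicator {1..} x * P x) u"
    by (intro mellin_convergent_add[OF mellin_convergent_cmult tail] convergent_monomial assms)
  thus ?thesis
  proof (rule mellin_convergent_bound)
    show "mellin_regular P p N \<in> borel_measurable pos_lborel"
      unfolding mellin_regular_def by measurable
    fix x :: real assume x: "x > 0"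
    show "\<bar>mellin_regular P p N x\<bar> \<le> \<bar>C * (x ^ N * indicator {0<..<1} x) + indicator {1..} x * P x\<bar>"
      using C[of x] x by (cases "x < 1") (auto simp: mellin_regular_def)
  qed
qed

text \<open>Removing one more monomial takes \<open>p N / (s + N)\<close> out of the integral, and
  the rational sum gains exactly this term.\<close>

lemma mellin_cont_Suc:
  assumes "Re s > - real N"
  shows "mellin_cont P p (Suc N) s = mellin_cont P p N s"
proof -
  have "mellin_regular P p (Suc N) = (\<lambda>x. mellin_regular P p N x - p N * (x ^ N * indicator {0<..<1} x))"
    by (simp add: mellin_regular_def fun_eq_iff)
  hence "mellin (mellin_regular P p (Suc N)) s
      = mellin (mellin_regular P p N) s - of_real (p N) * (1 / (s + of_nat N))"
    using assms by (simp add: mellin_diff convergent_regular mellin_convergent_cmult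
        convergent_monomial mellin_cmult mellin_monomial)
  thus ?thesis by (simp add: mellin_cont_def)
qed

lemma mellin_cont_eq:
  assumes "Re s > - real N" "N \<le> M"
  shows "mellin_cont P p M s = mellin_cont P p N s"
  using assms(2)
proof (induction M rule: dec_induct)
  case (step M)
  have "Re s > - real M" using step assms(1) by simp
  thus ?case using mellin_cont_Suc step.IH by simp
qed auto

text \<open>The number of removed terms grows as Re s decreases. The summand 1 makes Re s > - N
  strict for the chosen N, and \<open>nat\<close> gives N = 0 far to the right.\<close>

definition continuation :: "complex \<Rightarrow> complex" where
  "continuation s = mellin_cont P p (nat \<lceil>1 - Re s\<rceil>) s"

lemma continuation_eq:
  assumes "Re s > - real N"
  shows "continuation s = mellin_cont P p N s"
proof -
  let ?M = "nat \<lceil>1 - Re s\<rceil>"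
  have "Re s > - real ?M" by linarith
  thus ?thesis unfolding continuation_def
    using mellin_cont_eq[of ?M s N] mellin_cont_eq[of N s ?M] assms by (cases "N \<le> ?M") auto
qed

lemma continuation_eq_mellin: "Re s > 0 \<Longrightarrow> continuation s = mellin P s"
  using continuation_eq[of 0 s] by (simp add: mellin_cont_def mellin_regular_def[abs_def])

lemma regular_holomorphic:
  "mellin (mellin_regular P p N) holomorphic_on {s. Re s > - real N}"
  using mellin_holomorphic[of "{- real N<..}" "mellin_regular P p N"] convergent_regular by auto

text \<open>Near a point \<open>z\<close> the number of removed terms can be frozen at its value for
  \<open>z\<close>: the resulting formula is valid on an open half-plane containing
  \<open>z\<close>, and there it is a rational function plus a holomorphic one.\<close>

lemma continuation_meromorphic: "continuation meromorphic_on UNIV"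
  unfolding meromorphic_on_meromorphic_at[of _ UNIV]
proof
  fix z :: complex
  define N where "N = nat \<lceil>1 - Re z\<rceil>"
  have op: "open {s. Re s > - real N}" by (rule open_halfspace_Re_gt)
  have z: "z \<in> {s. Re s > - real N}" unfolding N_def by simp linarith
  have "mellin (mellin_regular P p N) analytic_on {s. Re s > - real N}"
    using regular_holomorphic op by (simp add: analytic_on_open)
  hence "mellin (mellin_regular P p N) meromorphic_on {z}"
    using z analytic_on_subset[of _ _ "{z}"] by (intro analytic_on_imp_meromorphic_on) auto
  hence "mellin_cont P p N meromorphic_on {z}"
    unfolding mellin_cont_def[abs_def] by (intro meromorphic_intros) 
  moreover have "eventually (\<lambda>w. continuation w = mellin_cont P p N w) (at z)"
    using eventually_at_in_open'[OF op z] by eventually_elim (auto intro: continuation_eq)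
  ultimately show "continuation meromorphic_on {z}"
    using meromorphic_on_cong[of "{z}" continuation "mellin_cont P p N" "{z}"] by auto
qed

end

section \<open>The Barnes series as a Mellin transform\<close>

text \<open>Transfers Euler's integral for \<open>Gamma\<close>, a gauge integral, to the Lebesgue
  integral used by \<open>mellin\<close>.\<close>

lemma integrable_pos_lborelI:
  fixes f :: "real \<Rightarrow> 'a::euclidean_space"
  assumes "f absolutely_integrable_on {0<..}" "f \<in> borel_measurable pos_lborel"
  shows "integrable pos_lborel f" "(\<integral>x. f x \<partial>pos_lborel) = integral {0<..} f"
proof -
  have m: "(\<lambda>x. indicator {0<..} x *\<^sub>R f x) \<in> borel_measurable lborel"
    using assms(2) by (subst (asm) borel_measurable_restrict_space_iff) auto
  show "integrable pos_lborel f"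
    using assms(1) m by (simp add: integrable_restrict_space set_integrable_def integrable_completion)
  have "(\<integral>x. f x \<partial>pos_lborel) = (\<integral>x. indicator {0<..} x *\<^sub>R f x \<partial>lborel)"
    by (simp add: integral_restrict_space)
  also have "\<dots> = (LINT x:{0<..}|lebesgue. f x)"
    unfolding set_lebesgue_integral_def using m by (simp add: integral_completion)
  also have "\<dots> = integral {0<..} f"
    using assms(1) by (rule set_lebesgue_integral_eq_integral(2))
  finally show "(\<integral>x. f x \<partial>pos_lborel) = integral {0<..} f" .
qed

lemma mellin_convergent_exp:
  assumes "u > 0" "b > 0"
  shows "mellin_convergent (\<lambda>x. exp (- b * x)) u"
proof -
  have "integrable pos_lborel (\<lambda>t. complex_of_real t powr (of_real u - 1) / of_real (exp (b * t)))"
    using assms absolutely_integrable_Gamma_integral[of "of_real u" b]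
    by (intro integrable_pos_lborelI) auto
  hence "integrable pos_lborel (\<lambda>t. norm (complex_of_real t powr (of_real u - 1) / of_real (exp (b * t))))"
    by (rule integrable_norm)
  also have "?this \<longleftrightarrow> ?thesis"
    unfolding mellin_convergent_def
    by (intro Bochner_Integration.integrable_cong)
       (auto simp: norm_divide norm_powr_real_powr exp_minus field_simps)
  finally show ?thesis .
qed

lemma pos_lborel_scale:
  fixes f :: "real \<Rightarrow> 'a::{banach, second_countable_topology}"
  assumes "c > 0"
  shows "(\<integral>x. f x \<partial>pos_lborel) = c *\<^sub>R (\<integral>x. f (c * x) \<partial>pos_lborel)"
proof -
  have "(\<integral>x. f x \<partial>pos_lborel) = (\<integral>x. indicator {0<..} x *\<^sub>R f x \<partial>lborel)"
    by (simp add: integral_restrict_space)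
  also have "\<dots> = \<bar>c\<bar> *\<^sub>R (\<integral>x. indicator {0<..} (0 + c * x) *\<^sub>R f (0 + c * x) \<partial>lborel)"
    using assms by (intro lborel_integral_real_affine) auto
  also have "(\<lambda>x. indicat_real {0<..} (0 + c * x) *\<^sub>R f (0 + c * x)) = (\<lambda>x. indicator {0<..} x *\<^sub>R f (c * x))"
    using assms by (auto simp: indicator_def zero_less_mult_iff fun_eq_iff)
  finally show ?thesis
    using assms by (simp add: integral_restrict_space)
qed

text \<open>Euler's integral for \<open>Gamma s\<close> after the substitution t = b x.\<close>

lemma mellin_exp:
  assumes "Re s > 0" "b > 0"
  shows "mellin (\<lambda>x. exp (- b * x)) s = Gamma s * complex_of_real b powr (- s)"
proof -
  have "Gamma s = integral {0<..} (\<lambda>t. of_real t powr (s - 1) / of_real (exp t))"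
    using Gamma_integral_complex'[OF assms(1)] by (simp add: integral_unique)
  also have "\<dots> = (\<integral>t. of_real t powr (s - 1) / of_real (exp t) \<partial>pos_lborel)"
    using assms absolutely_integrable_Gamma_integral'[of s]
    by (intro integrable_pos_lborelI(2)[symmetric]) auto
  also have "\<dots> = b *\<^sub>R (\<integral>t. of_real (b * t) powr (s - 1) / of_real (exp (b * t)) \<partial>pos_lborel)"
    by (rule pos_lborel_scale) fact
  also have "(\<integral>t. of_real (b * t) powr (s - 1) / of_real (exp (b * t)) \<partial>pos_lborel)
      = (\<integral>t. of_real b powr (s - 1) * (of_real t powr (s - 1) * of_real (exp (- b * t))) \<partial>pos_lborel)"
    using assms(2)
    by (intro Bochner_Integration.integral_cong) (auto simp: powr_times_real exp_minus field_simps)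
  also have "\<dots> = of_real b powr (s - 1) * mellin (\<lambda>x. exp (- b * x)) s"
    unfolding mellin_def by (rule integral_mult_right_zero)
  also have "b *\<^sub>R \<dots> = complex_of_real b powr s * mellin (\<lambda>x. exp (- b * x)) s"
    using assms(2) by (simp add: scaleR_conv_of_real powr_diff)
  finally show ?thesis using assms(2) by (simp add: powr_minus field_simps)
qed

text \<open>Since the terms are nonnegative, every partial sum is at most \<open>H\<close>, so
  \<open>H\<close> itself provides the majorant for dominated convergence.\<close>

lemma mellin_sums:
  assumes conv: "\<And>m. mellin_convergent (h m) (Re s)" "mellin_convergent H (Re s)"
    and nonneg: "\<And>m x. x > 0 \<Longrightarrow> h m x \<ge> 0"
    and sums: "\<And>x. x > 0 \<Longrightarrow> (\<lambda>m. h m x) sums H x"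
  shows "(\<lambda>m. mellin (h m) s) sums mellin H s"
proof -
  note [measurable] = mellin_convergent_measurable[OF conv(1)] mellin_convergent_measurable[OF conv(2)]
  let ?q = "\<lambda>x. complex_of_real x powr (s - 1)"
  have *: "(\<Sum>m<n. mellin (h m) s) = (\<integral>x. ?q x * of_real (\<Sum>m<n. h m x) \<partial>pos_lborel)" for n
    unfolding mellin_def using mellin_integrable[OF conv(1)]
    by (subst Bochner_Integration.integral_sum [symmetric]) (auto simp: sum_distrib_left)
  have "(\<lambda>n. \<integral>x. ?q x * of_real (\<Sum>m<n. h m x) \<partial>pos_lborel)
          \<longlonglongrightarrow> (\<integral>x. ?q x * of_real (H x) \<partial>pos_lborel)"
  proof (rule integral_dominated_convergence)
    show "integrable pos_lborel (\<lambda>x. x powr (Re s - 1) * H x)"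
      using conv(2) by (simp add: mellin_convergent_def)
    show "AE x in pos_lborel. (\<lambda>n. ?q x * of_real (\<Sum>m<n. h m x)) \<longlonglongrightarrow> ?q x * of_real (H x)"
      by (intro AE_pos_lborelI tendsto_intros) (use sums in \<open>auto simp: sums_def\<close>)
    show "AE x in pos_lborel. norm (?q x * of_real (\<Sum>m<n. h m x)) \<le> x powr (Re s - 1) * H x" for n
    proof (rule AE_pos_lborelI)
      fix x :: real assume x: "x > 0"
      have "(\<Sum>m<n. h m x) \<le> H x"
        using sum_le_suminf[OF sums_summable[OF sums[OF x]], of "{..<n}"] nonneg[OF x]
          sums_unique[OF sums[OF x]] by auto
      moreover have "(\<Sum>m<n. h m x) \<ge> 0" using nonneg[OF x] by (intro sum_nonneg) auto
      moreover have "norm (?q x * of_real (\<Sum>m<n. h m x)) = x powr (Re s - 1) * \<bar>\<Sum>m<n. h m x\<bar>"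
        using x norm_powr_real_powr[of "of_real x" "s - 1"] by (simp add: norm_mult del: of_real_sum)
      ultimately show "norm (?q x * of_real (\<Sum>m<n. h m x)) \<le> x powr (Re s - 1) * H x"
        by (simp add: mult_left_mono)
    qed
  qed measurable
  thus ?thesis unfolding sums_def * unfolding mellin_def .
qed

text \<open>A rearrangement of 1 + y <= \<open>exp y\<close>. It shows that each geometric factor
  costs at most one power of \<open>x\<close> at the origin and thus moves the abscissa of
  convergence by one: from 0 to 1, then to 2.\<close>

lemma inverse_one_minus_exp_le:
  fixes y :: real
  assumes "y > 0"
  shows "1 / (1 - exp (- y)) \<le> 1 + 1 / y"
proof -
  have "(1 + y) * exp (- y) \<le> exp y * exp (- y)"
    by (intro mult_right_mono) auto
  hence "(1 + y) * exp (- y) \<le> 1" by (simp flip: exp_add)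
  thus ?thesis using assms by (simp add: field_simps)
qed

lemma mellin_convergent_exp_over:
  assumes "u > 1" "b > 0" "w > 0"
  shows "mellin_convergent (\<lambda>x. exp (- b * x) / (1 - exp (- w * x))) u"
proof -
  have "mellin_convergent (\<lambda>x. exp (- b * x) + (1 / w) * (x powr (-1) * exp (- b * x))) u"
    using assms
    by (intro mellin_convergent_add mellin_convergent_cmult mellin_convergent_shift[THEN iffD2]
          mellin_convergent_exp) auto
  thus ?thesis
  proof (rule mellin_convergent_bound)
    fix x :: real assume x: "x > 0"
    have "exp (- b * x) * (1 / (1 - exp (- (w * x)))) \<le> exp (- b * x) * (1 + 1 / (w * x))"
      using inverse_one_minus_exp_le[of "w * x"] assms x by (intro mult_left_mono) auto
    thus "\<bar>exp (- b * x) / (1 - exp (- w * x))\<bar> \<le> \<bar>exp (- b * x) + (1 / w) * (x powr (-1) * exp (- b * x))\<bar>"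
      using x assms by (simp add: powr_minus field_simps)
  qed measurable
qed

text \<open>The function G of the overview: the double sum of
  \<open>exp (- (a + m1 * w1 + m2 * w2) * x)\<close>, evaluated as two geometric series.\<close>

definition barnes_laplace :: "real \<Rightarrow> real \<Rightarrow> real \<Rightarrow> real \<Rightarrow> real" where
  "barnes_laplace w1 w2 a x = exp (- a * x) / ((1 - exp (- w1 * x)) * (1 - exp (- w2 * x)))"

lemma mellin_convergent_barnes_laplace:
  assumes "u > 2" "a > 0" "w1 > 0" "w2 > 0"
  shows "mellin_convergent (barnes_laplace w1 w2 a) u"
proof -
  let ?g = "\<lambda>x. exp (- a * x) / (1 - exp (- w1 * x))"
  have "mellin_convergent (\<lambda>x. ?g x + (1 / w2) * (x powr (-1) * ?g x)) u"
    using assms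
    by (intro mellin_convergent_add mellin_convergent_cmult mellin_convergent_shift[THEN iffD2]
          mellin_convergent_exp_over) auto
  thus ?thesis
  proof (rule mellin_convergent_bound)
    show "barnes_laplace w1 w2 a \<in> borel_measurable pos_lborel"
      unfolding barnes_laplace_def by measurable
    fix x :: real assume x: "x > 0"
    have pos: "1 - exp (- w1 * x) > 0" "1 - exp (- w2 * x) > 0" using x assms by auto
    have "?g x * (1 / (1 - exp (- (w2 * x)))) \<le> ?g x * (1 + 1 / (w2 * x))"
      using inverse_one_minus_exp_le[of "w2 * x"] assms x by (intro mult_left_mono) auto
    also have "t * (1 + 1 / (w2 * x)) = t + (1 / w2) * (x powr (-1) * t)" for t
      using x assms(4) by (simp add: powr_minus field_simps)
    finally have "barnes_laplace w1 w2 a x \<le> ?g x + (1 / w2) * (x powr (-1) * ?g x)"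
      by (simp add: barnes_laplace_def)
    moreover have "barnes_laplace w1 w2 a x \<ge> 0"
      using pos by (simp add: barnes_laplace_def)
    ultimately show "\<bar>barnes_laplace w1 w2 a x\<bar> \<le> \<bar>?g x + (1 / w2) * (x powr (-1) * ?g x)\<bar>"
      by linarith
  qed
qed

lemma exp_progression_sums:
  fixes x w b :: real
  assumes "x > 0" "w > 0"
  shows "(\<lambda>m. exp (- (b + real m * w) * x)) sums (exp (- b * x) / (1 - exp (- w * x)))"
proof -
  have "(\<lambda>m. exp (- b * x) * exp (- w * x) ^ m) sums (exp (- b * x) * (1 / (1 - exp (- w * x))))"
    using assms by (intro sums_mult geometric_sums) auto
  moreover have "exp (- b * x) * exp (- w * x) ^ m = exp (- (b + real m * w) * x)" for m
    by (simp add: exp_of_nat_mult[symmetric] exp_add[symmetric] algebra_simps)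
  ultimately show ?thesis by simp
qed

text \<open>Two applications of \<open>mellin_sums\<close>, first over \<open>m2\<close> with
  \<open>m1\<close> fixed and then over \<open>m1\<close>, follow the order of the iterated series.
  Each summand is an exponential, whose transform carries the factor \<open>Gamma s\<close> that
  \<open>rGamma s\<close> cancels.\<close>

lemma barnes_zeta2_series_eq_mellin:
  assumes "a > 0" "w1 > 0" "w2 > 0" "Re s > 2"
  shows "barnes_zeta2_series w1 w2 a s = rGamma s * mellin (barnes_laplace w1 w2 a) s"
proof -
  have G: "Gamma s \<noteq> 0" using assms by (auto simp: Gamma_eq_zero_iff elim!: nonpos_Ints_cases)
  have inner: "(\<lambda>m. mellin (\<lambda>x. exp (- (b + real m * w2) * x)) s)
       sums mellin (\<lambda>x. exp (- b * x) / (1 - exp (- w2 * x))) s" if b: "b > 0" for b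
    using assms b by (intro mellin_sums exp_progression_sums mellin_convergent_exp mellin_convergent_exp_over)
      (auto intro: add_pos_nonneg)
  have inner': "(\<Sum>m2. complex_of_real (a + real m1 * w1 + real m2 * w2) powr (- s))
      = rGamma s * mellin (\<lambda>x. exp (- (a + real m1 * w1) * x) / (1 - exp (- w2 * x))) s" for m1
  proof -
    have pos: "a + real m1 * w1 > 0" using assms by (intro add_pos_nonneg) auto
    have pos': "a + real m1 * w1 + real m2 * w2 > 0" for m2 using pos assms by (intro add_pos_nonneg) auto
    have "(\<lambda>m2. rGamma s * mellin (\<lambda>x. exp (- (a + real m1 * w1 + real m2 * w2) * x)) s)
            sums (rGamma s * mellin (\<lambda>x. exp (- (a + real m1 * w1) * x) / (1 - exp (- w2 * x))) s)"
      by (intro sums_mult inner pos)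
    also have "(\<lambda>m2. rGamma s * mellin (\<lambda>x. exp (- (a + real m1 * w1 + real m2 * w2) * x)) s)
        = (\<lambda>m2. complex_of_real (a + real m1 * w1 + real m2 * w2) powr (- s))"
      using assms(4) G pos' by (subst mellin_exp) (auto simp: rGamma_inverse_Gamma)
    finally show ?thesis by (rule sums_unique[symmetric])
  qed
  have "(\<lambda>m1. mellin (\<lambda>x. exp (- (a + real m1 * w1) * x) / (1 - exp (- w2 * x))) s)
      sums mellin (barnes_laplace w1 w2 a) s"
  proof (rule mellin_sums)
    show "mellin_convergent (\<lambda>x. exp (- (a + real m1 * w1) * x) / (1 - exp (- w2 * x))) (Re s)" for m1
      using assms by (intro mellin_convergent_exp_over add_pos_nonneg) auto
    show "mellin_convergent (barnes_laplace w1 w2 a) (Re s)"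
      by (intro mellin_convergent_barnes_laplace assms)
    fix x :: real assume x: "x > 0"
    show "exp (- (a + real m1 * w1) * x) / (1 - exp (- w2 * x)) \<ge> 0" for m1
      using x assms by simp
    have "(\<lambda>m1. exp (- (a + real m1 * w1) * x) / (1 - exp (- w2 * x)))
            sums (exp (- a * x) / (1 - exp (- w1 * x)) / (1 - exp (- w2 * x)))"
      by (intro sums_divide exp_progression_sums x assms)
    thus "(\<lambda>m1. exp (- (a + real m1 * w1) * x) / (1 - exp (- w2 * x))) sums barnes_laplace w1 w2 a x"
      by (simp add: barnes_laplace_def)
  qed
  hence "(\<lambda>m1. rGamma s * mellin (\<lambda>x. exp (- (a + real m1 * w1) * x) / (1 - exp (- w2 * x))) s)
      sums (rGamma s * mellin (barnes_laplace w1 w2 a) s)"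
    by (rule sums_mult)
  thus ?thesis unfolding barnes_zeta2_series_def inner'
    by (rule sums_unique[symmetric])
qed

section \<open>The expansion of the kernel at 0\<close>

lemma power_series_remainder_bound:
  fixes c :: "nat \<Rightarrow> real"
  assumes r: "r > 0" and sums: "\<And>x. 0 < x \<Longrightarrow> x < r \<Longrightarrow> (\<lambda>n. c n * x ^ n) sums f x"
  shows "\<exists>C. \<forall>x. 0 < x \<longrightarrow> x \<le> r / 2 \<longrightarrow> \<bar>f x - (\<Sum>n<N. c n * x ^ n)\<bar> \<le> C * x ^ N"
proof (intro exI allI impI)
  fix x :: real assume x: "0 < x" "x \<le> r / 2"
  \<comment> \<open>Convergence at 3r/4 gives absolute convergence at r/2. After
    \<open>x ^ N\<close> is factored out, the constant is the sum of
    \<open>\<bar>c (n + N)\<bar> * (r / 2) ^ n\<close>.\<close>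
  have "summable (\<lambda>n. c n * (3 / 4 * r) ^ n)"
    using sums[of "3 / 4 * r"] r by (auto simp: sums_iff)
  hence "summable (\<lambda>n. norm (c n * (r / 2) ^ n))"
    using r by (intro powser_insidea[of _ "3 / 4 * r"]) auto
  hence "summable (\<lambda>n. norm (c (n + N) * (r / 2) ^ (n + N)))"
    by (rule summable_ignore_initial_segment)
  hence "summable (\<lambda>n. norm (c (n + N) * (r / 2) ^ (n + N)) / (r / 2) ^ N)"
    by (rule summable_divide)
  hence S: "summable (\<lambda>n. \<bar>c (n + N)\<bar> * (r / 2) ^ n)"
    using r by (simp add: abs_mult power_add)
  have le: "norm (c (n + N) * x ^ n) \<le> \<bar>c (n + N)\<bar> * (r / 2) ^ n" for n
    using x by (auto simp: abs_mult intro!: mult_left_mono power_mono)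
  have S': "summable (\<lambda>n. norm (c (n + N) * x ^ n))"
    using le by (intro summable_comparison_test'[OF S]) auto
  have fx: "(\<lambda>n. c n * x ^ n) sums f x" using sums x r by auto
  have "f x = (\<Sum>n. c (n + N) * x ^ (n + N)) + (\<Sum>n<N. c n * x ^ n)"
    using suminf_split_initial_segment[OF sums_summable[OF fx], of N] sums_unique[OF fx] by simp
  moreover have "(\<Sum>n. c (n + N) * x ^ (n + N)) = (\<Sum>n. c (n + N) * x ^ n) * x ^ N"
    using suminf_mult2[OF summable_norm_cancel[OF S'], of "x ^ N"] by (simp add: power_add mult_ac)
  ultimately have "\<bar>f x - (\<Sum>n<N. c n * x ^ n)\<bar> = \<bar>\<Sum>n. c (n + N) * x ^ n\<bar> * x ^ N"
    using x by (simp add: abs_mult)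
  also have "\<bar>\<Sum>n. c (n + N) * x ^ n\<bar> \<le> (\<Sum>n. norm (c (n + N) * x ^ n))"
    using summable_norm[OF S'] by simp
  also have "\<dots> \<le> (\<Sum>n. \<bar>c (n + N)\<bar> * (r / 2) ^ n)"
    by (intro suminf_le le S S')
  finally show "\<bar>f x - (\<Sum>n<N. c n * x ^ n)\<bar> \<le> (\<Sum>n. \<bar>c (n + N)\<bar> * (r / 2) ^ n) * x ^ N"
    using x by (simp add: mult_right_mono)
qed

text \<open>The function P of the overview; the square cancels the double pole of
  \<open>barnes_laplace\<close> at 0.\<close>

definition barnes_kernel :: "real \<Rightarrow> real \<Rightarrow> real \<Rightarrow> real \<Rightarrow> real" where
  "barnes_kernel w1 w2 a x = x\<^sup>2 * barnes_laplace w1 w2 a x"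

lemma barnes_kernel_power_series:
  assumes "w1 > 0" "w2 > 0"
  obtains c r where "r > 0"
    "\<And>x. 0 < x \<Longrightarrow> x < r \<Longrightarrow> (\<lambda>n. c n * x ^ n) sums barnes_kernel w1 w2 a x"
proof -
  \<comment> \<open>\<open>Q w\<close> is (1 - exp (- w z)) / z with its singularity at 0 filled in.
    Writing it as a difference quotient of - exp (- w z) puts it in the form required by
    \<open>pole_lemma\<close>.\<close>
  define Q :: "real \<Rightarrow> complex \<Rightarrow> complex" where
    "Q w z = (if z = 0 then deriv (\<lambda>z. - exp (- of_real w * z)) 0
              else (- exp (- of_real w * z) - - exp (- of_real w * 0)) / (z - 0))" for w z
  have hol: "Q w holomorphic_on UNIV" for w
    unfolding Q_def by (rule pole_lemma) (auto intro!: holomorphic_intros)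
  have Q0: "Q w 0 = of_real w" for w
    unfolding Q_def by (auto intro!: DERIV_imp_deriv derivative_eq_intros)
  have "continuous_on UNIV (\<lambda>z. Q w1 z * Q w2 z)"
    by (intro continuous_intros holomorphic_on_imp_continuous_on hol)
  hence "open ((\<lambda>z. Q w1 z * Q w2 z) -` (- {0}))"
    by (intro open_vimage) auto
  moreover have "0 \<in> (\<lambda>z. Q w1 z * Q w2 z) -` (- {0})"
    using assms by (simp add: Q0)
  \<comment> \<open>At 0 the product equals \<open>w1 * w2\<close>, which is nonzero, so by
    continuity it has no zero on a small disc, and the quotient \<open>K\<close> is holomorphic
    there.\<close>
  ultimately obtain r where r: "r > 0" "ball 0 r \<subseteq> (\<lambda>z. Q w1 z * Q w2 z) -` (- {0})"
    by (meson openE)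
  define K where "K z = exp (- of_real a * z) / (Q w1 z * Q w2 z)" for z
  have "K holomorphic_on ball 0 r"
    unfolding K_def using r(2)
    by (intro holomorphic_intros holomorphic_on_subset[OF hol]) auto
  hence ps: "(\<lambda>n. (deriv ^^ n) K 0 / fact n * (z - 0) ^ n) sums K z" if "z \<in> ball 0 r" for z
    using that by (rule holomorphic_power_series)
  show ?thesis
  \<comment> \<open>\<open>K\<close> takes real values at positive reals, so the real parts of its
    Taylor coefficients already represent the kernel.\<close>
  proof (rule that[of r "\<lambda>n. Re ((deriv ^^ n) K 0 / fact n)"])
    fix x :: real assume x: "0 < x" "x < r"
    have "K (of_real x) = of_real (barnes_kernel w1 w2 a x)"
      using x by (simp add: K_def Q_def barnes_kernel_def barnes_laplace_def power2_eq_square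
          flip: exp_of_real)
    hence "(\<lambda>n. (deriv ^^ n) K 0 / fact n * of_real (x ^ n)) sums of_real (barnes_kernel w1 w2 a x)"
      using ps[of "of_real x"] x by simp
    from sums_Re[OF this] show "(\<lambda>n. Re ((deriv ^^ n) K 0 / fact n) * x ^ n) sums barnes_kernel w1 w2 a x"
      by (simp only: Re_complex_of_real times_complex.sel Im_complex_of_real) simp
  qed fact
qed

lemma continuous_on_barnes_kernel:
  "w1 > 0 \<Longrightarrow> w2 > 0 \<Longrightarrow> continuous_on {0<..} (barnes_kernel w1 w2 a)"
  unfolding barnes_kernel_def barnes_laplace_def by (intro continuous_intros) auto

lemma mellin_barnes_kernel:
  "mellin (barnes_kernel w1 w2 a) s = mellin (barnes_laplace w1 w2 a) (s + 2)"
  using mellin_shift[of 2 "barnes_laplace w1 w2 a" s]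
    mellin_cong[of "barnes_kernel w1 w2 a" "\<lambda>x. x powr 2 * barnes_laplace w1 w2 a x"]
  by (simp add: barnes_kernel_def)

lemma mellin_convergent_barnes_kernel:
  assumes "u > 0" "a > 0" "w1 > 0" "w2 > 0"
  shows "mellin_convergent (barnes_kernel w1 w2 a) u"
  using mellin_convergent_shift[of 2 "barnes_laplace w1 w2 a" u]
    mellin_convergent_cong[of "barnes_kernel w1 w2 a" "\<lambda>x. x powr 2 * barnes_laplace w1 w2 a x"]
    mellin_convergent_barnes_laplace[of "u + 2" a w1 w2] assms
  by (simp add: barnes_kernel_def)

lemma mellin_convergent_tail:
  assumes "mellin_convergent h v" "u \<le> v"
  shows "mellin_convergent (\<lambda>x. indicator {1..} x * h x) u"
  unfolding mellin_convergent_def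
proof (rule Bochner_Integration.integrable_bound)
  note [measurable] = mellin_convergent_measurable[OF assms(1)]
  show "integrable pos_lborel (\<lambda>x. x powr (v - 1) * h x)"
    using assms by (simp add: mellin_convergent_def)
  show "(\<lambda>x. x powr (u - 1) * (indicator {1..} x * h x)) \<in> borel_measurable pos_lborel"
    by measurable
  show "AE x in pos_lborel. norm (x powr (u - 1) * (indicator {1..} x * h x)) \<le> norm (x powr (v - 1) * h x)"
    using assms(2)
    by (intro AE_pos_lborelI) (auto simp: abs_mult indicator_def intro!: mult_right_mono powr_mono)
qed

text \<open>Up to \<open>r / 2\<close> the remainder is controlled by the power series, and on the
  rest of (0,1) by compactness, where \<open>x ^ N\<close> is bounded below by
  \<open>(r / 2) ^ N\<close>.\<close>

lemma barnes_kernel_mellin_continuation: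
  assumes "a > 0" "w1 > 0" "w2 > 0"
  obtains p where "mellin_continuation (barnes_kernel w1 w2 a) p"
proof -
  let ?P = "barnes_kernel w1 w2 a"
  obtain p r where r: "r > 0" and
    ps: "\<And>x. 0 < x \<Longrightarrow> x < r \<Longrightarrow> (\<lambda>n. p n * x ^ n) sums ?P x"
    by (rule barnes_kernel_power_series[OF assms(2,3), of a]) (rule that)
  have "mellin_continuation ?P p"
  proof
    show "mellin_convergent (\<lambda>x. indicator {1..} x * ?P x) u" for u
      by (rule mellin_convergent_tail[of _ "max u 1"]) (use assms in \<open>auto intro!: mellin_convergent_barnes_kernel\<close>)
    show "?P \<in> borel_measurable pos_lborel"
      using mellin_convergent_measurable[OF mellin_convergent_barnes_kernel[of 1]] assms by auto
    fix N
    let ?R = "\<lambda>x. ?P x - (\<Sum>n<N. p n * x ^ n)"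
    obtain C where C: "\<And>x. 0 < x \<Longrightarrow> x \<le> r / 2 \<Longrightarrow> \<bar>?R x\<bar> \<le> C * x ^ N"
      using power_series_remainder_bound[of r p ?P N] r ps by blast
    have "continuous_on {r / 2..1} ?R"
      using r assms by (intro continuous_intros continuous_on_subset[OF continuous_on_barnes_kernel]) auto
    hence "bounded (?R ` {r / 2..1})"
      by (intro compact_imp_bounded compact_continuous_image) auto
    then obtain B where "\<forall>x\<in>{r / 2..1}. \<bar>?R x\<bar> \<le> B"
      by (auto simp: bounded_iff)
    hence B: "\<bar>?R x\<bar> \<le> B" if "r / 2 \<le> x" "x \<le> 1" for x
      using that by simp
    have "\<bar>?R x\<bar> \<le> max C (B / (r / 2) ^ N) * x ^ N" if x: "0 < x" "x < 1" for x
    proof (cases "x \<le> r / 2")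
      case True
      have "\<bar>?R x\<bar> \<le> C * x ^ N" using C x True by auto
      also have "\<dots> \<le> max C (B / (r / 2) ^ N) * x ^ N" using x by (intro mult_right_mono) auto
      finally show ?thesis .
    next
      case False
      have "\<bar>?R x\<bar> \<le> B" using B x False by auto
      also have "B = B / (r / 2) ^ N * (r / 2) ^ N" using r by simp
      \<comment> \<open>The bound on \<open>\<bar>?R x\<bar>\<close> also supplies nonnegativity of
        \<open>B\<close>, which the monotonicity needs.\<close>
      also have "\<dots> \<le> B / (r / 2) ^ N * x ^ N"
        using False r \<open>\<bar>?R x\<bar> \<le> B\<close> by (intro mult_left_mono power_mono) auto
      also have "\<dots> \<le> max C (B / (r / 2) ^ N) * x ^ N" using x by (intro mult_right_mono) auto
      finally show ?thesis .
    qed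
    thus "\<exists>C. \<forall>x. 0 < x \<longrightarrow> x < 1 \<longrightarrow> \<bar>?R x\<bar> \<le> C * x ^ N" by blast
  qed
  thus ?thesis by (rule that)
qed

section \<open>Uniqueness of the meromorphic continuation\<close>

lemma nicely_meromorphic_eqI:
  assumes f: "f nicely_meromorphic_on UNIV" and g: "g nicely_meromorphic_on UNIV"
    and eq: "frequently (\<lambda>z. f z = g z) (at z0)"
  shows "f = g"
proof
  fix z
  have "\<not> eventually (\<lambda>w. f w - g w \<noteq> 0) (at z0)"
    using eq by (simp add: frequently_def)
  moreover have "(\<lambda>w. f w - g w) meromorphic_on UNIV"
    using f g by (intro meromorphic_intros) (auto simp: nicely_meromorphic_on_def)
  \<comment> \<open>The difference is meromorphic on the plane and does not avoid 0 near
    \<open>z0\<close>, so it vanishes off a sparse set.\<close>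
  ultimately have "eventually (\<lambda>w. f w - g w = 0) (cosparse UNIV)"
    using meromorphic_imp_constant_or_avoid[of "\<lambda>w. f w - g w" UNIV 0]
    by (auto simp: eventually_cosparse_open_eq)
  hence "eventually (\<lambda>w. f w = g w) (at z)"
    by (simp add: eventually_cosparse_open_eq)
  hence "remove_sings f z = remove_sings g z"
    by (rule remove_sings_cong) simp
  \<comment> \<open>The values at the exceptional points agree as well: a nicely meromorphic
    function equals its limit where that exists and 0 at a pole, which are the conventions of
    \<open>remove_sings\<close>.\<close>
  moreover have "remove_sings h z = h z" if "h nicely_meromorphic_on UNIV" for h
  proof -
    have "is_pole h z \<and> h z = 0 \<or> h \<midarrow>z\<rightarrow> h z"
      using that by (simp add: nicely_meromorphic_on_def)
    thus ?thesis by auto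
  qed
  ultimately show "f z = g z" using f g by simp
qed

lemma barnes_zeta2_eqI:
  assumes "f nicely_meromorphic_on UNIV" "\<And>s. Re s > 2 \<Longrightarrow> f s = barnes_zeta2_series w1 w2 a s"
  shows "barnes_zeta2 w1 w2 a = f"
  unfolding barnes_zeta2_def
proof (rule the_equality)
  fix g assume g: "g nicely_meromorphic_on UNIV \<and> (\<forall>s. Re s > 2 \<longrightarrow> g s = barnes_zeta2_series w1 w2 a s)"
  \<comment> \<open>The point 3 is interior to the half-plane of the series, so two candidates agree
    near it.\<close>
  have "eventually (\<lambda>z. z \<in> {s. Re s > 2}) (at 3)"
    by (intro eventually_at_in_open' open_halfspace_Re_gt) auto
  hence "eventually (\<lambda>z. g z = f z) (at 3)"
    by eventually_elim (use g assms(2) in auto)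
  hence "frequently (\<lambda>z. g z = f z) (at 3)"
    by (intro eventually_frequently) auto
  thus "g = f" using nicely_meromorphic_eqI assms(1) g by blast
qed (use assms in auto)

section \<open>The strip -1 < Re s < 0 and the first two coefficients\<close>

context mellin_continuation
begin

text \<open>At 0 the difference is of order \<open>x\<close>, whence the lower limit -1; at infinity
  it tends to the constant \<open>- p 0\<close>, whence the upper limit 0.\<close>

lemma convergent_minus_const:
  assumes "-1 < u" "u < 0"
  shows "mellin_convergent (\<lambda>x. P x - p 0) u"
proof -
  have "mellin_convergent (\<lambda>x. mellin_regular P p 1 x - p 0 * indicator {1..} x) u"
    using assms by (intro mellin_convergent_diff mellin_convergent_cmult convergent_regular mellin_convergent_beyond_1) auto
  also have "?this \<longleftrightarrow> ?thesis"
    by (rule mellin_convergent_cong) (auto simp: mellin_regular_def indicator_def)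
  finally show ?thesis .
qed

text \<open>Subtracting \<open>p 0\<close> on [1,infinity) as well contributes
  \<open>p 0 / s\<close> when Re s < 0, which is exactly the polar term of
  \<open>mellin_cont\<close> with N = 1.\<close>

lemma continuation_eq_mellin_minus_const:
  assumes "-1 < Re s" "Re s < 0"
  shows "continuation s = mellin (\<lambda>x. P x - p 0) s"
proof -
  have "mellin (\<lambda>x. P x - p 0) s = mellin (\<lambda>x. mellin_regular P p 1 x - p 0 * indicator {1..} x) s"
    by (rule mellin_cong) (auto simp: mellin_regular_def indicator_def)
  also have "\<dots> = mellin (mellin_regular P p 1) s - of_real (p 0) * mellin (indicator {1..}) s"
    using assms by (subst mellin_diff) (auto simp: mellin_cmult
        intro!: mellin_convergent_cmult convergent_regular mellin_convergent_beyond_1)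
  also have "\<dots> = mellin_cont P p 1 s"
    using assms by (simp add: mellin_beyond_1 mellin_cont_def)
  also have "\<dots> = continuation s"
    using assms by (intro continuation_eq[symmetric]) auto
  finally show ?thesis by simp
qed

text \<open>The coefficients come from an existence statement; this limit and the next one tie
  \<open>p 0\<close> and \<open>p 1\<close> to the explicit kernel.\<close>

lemma tendsto_coeff_0: "(P \<longlongrightarrow> p 0) (at_right 0)"
proof -
  obtain C where C: "\<And>x. 0 < x \<Longrightarrow> x < 1 \<Longrightarrow> \<bar>P x - p 0\<bar> \<le> C * x"
    using expansion[of 1] by auto
  have "((\<lambda>x. C * x) \<longlongrightarrow> C * 0) (at_right 0)" by (intro tendsto_intros)
  hence "((\<lambda>x. P x - p 0) \<longlongrightarrow> 0) (at_right 0)"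
    by (intro Lim_null_comparison[of "\<lambda>x. P x - p 0" "\<lambda>x. C * x"])
       (auto simp: eventually_at_right_field intro!: exI[of _ 1] C)
  thus ?thesis by (simp add: LIM_zero_iff)
qed

lemma tendsto_coeff_1: "((\<lambda>x. (P x - p 0) / x) \<longlongrightarrow> p 1) (at_right 0)"
proof -
  obtain C where C: "\<And>x. 0 < x \<Longrightarrow> x < 1 \<Longrightarrow> \<bar>P x - (p 0 + p 1 * x)\<bar> \<le> C * x\<^sup>2"
    using expansion[of 2] by (auto simp: numeral_2_eq_2)
  have *: "\<bar>(P x - p 0) / x - p 1\<bar> \<le> C * x" if "0 < x" "x < 1" for x
  proof -
    have "\<bar>(P x - p 0) / x - p 1\<bar> = \<bar>P x - (p 0 + p 1 * x)\<bar> / x"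
      using that by (subst abs_of_pos[symmetric, of x], simp, subst abs_divide[symmetric]) (simp add: field_simps)
    also have "\<dots> \<le> C * x\<^sup>2 / x" using C that by (intro divide_right_mono) auto
    finally show ?thesis using that by (simp add: power2_eq_square)
  qed
  have "((\<lambda>x. C * x) \<longlongrightarrow> C * 0) (at_right 0)" by (intro tendsto_intros)
  hence "((\<lambda>x. (P x - p 0) / x - p 1) \<longlongrightarrow> 0) (at_right 0)"
    by (intro Lim_null_comparison[of "\<lambda>x. (P x - p 0) / x - p 1" "\<lambda>x. C * x"])
       (auto simp: eventually_at_right_field simp del: One_nat_def intro!: exI[of _ 1] *)
  thus ?thesis by (simp add: LIM_zero_iff)
qed

end

section \<open>The sign of the reduced kernel\<close>

definition log_sinhc_slope :: "real \<Rightarrow> real" where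
  "log_sinhc_slope y = ln (sinh y / y) / y"

lemma log_sinhc_slope_at_0: "(log_sinhc_slope \<longlongrightarrow> 0) (at_right 0)"
  unfolding log_sinhc_slope_def by real_asymp

lemma log_sinhc_slope_at_top: "(log_sinhc_slope \<longlongrightarrow> 1) at_top"
  unfolding log_sinhc_slope_def by real_asymp

text \<open>A limit preserves only weak inequalities; passing through \<open>f (y / 2)\<close>
  recovers the strict one.\<close>

lemma strict_mono_tendsto_less:
  fixes f :: "real \<Rightarrow> real"
  assumes mono: "\<And>x y. 0 < x \<Longrightarrow> x < y \<Longrightarrow> f x < f y" and lim: "(f \<longlongrightarrow> l) (at_right 0)" and "y > 0"
  shows "l < f y"
proof -
  have "eventually (\<lambda>x. f x \<le> f (y / 2)) (at_right 0)"
    unfolding eventually_at_right_field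
    using assms(3) by (intro exI[of _ "y / 2"]) (auto intro!: less_imp_le mono)
  hence "l \<le> f (y / 2)"
    by (intro tendsto_upperbound[OF lim]) auto
  also have "\<dots> < f y" using assms(3) by (intro mono) auto
  finally show ?thesis .
qed

lemma sinh_gt_self:
  fixes y :: real
  assumes "y > 0"
  shows "sinh y > y"
proof -
  have "0 < sinh y - y"
  proof (rule strict_mono_tendsto_less[of "\<lambda>y. sinh y - y"])
    show "((\<lambda>y::real. sinh y - y) \<longlongrightarrow> 0) (at_right 0)" by real_asymp
    fix x z :: real assume "0 < x" "x < z"
    thus "sinh x - x < sinh z - z"
    proof (intro DERIV_pos_imp_increasing[of x z "\<lambda>y. sinh y - y"])
      fix t :: real assume t: "x \<le> t" "t \<le> z"
      have "((\<lambda>y. sinh y - y) has_real_derivative (cosh t - 1)) (at t)"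
        by (auto intro!: derivative_eq_intros)
      moreover have "cosh t > 1" using t \<open>0 < x\<close> cosh_real_strict_mono[of 0 t] by simp
      ultimately show "\<exists>d. ((\<lambda>y. sinh y - y) has_real_derivative d) (at t) \<and> d > 0" by force
    qed
  qed fact
  thus ?thesis by simp
qed

text \<open>By the quotient rule the derivative is \<open>m t / t\<^sup>2\<close>. The numerator
  \<open>m\<close> tends to 0 at the origin and increases, since its derivative 1/t - t/(sinh t)^2
  is positive by sinh t > t; hence \<open>m\<close> is positive.\<close>

lemma log_sinhc_slope_strict_mono:
  assumes "0 < x" "x < y"
  shows "log_sinhc_slope x < log_sinhc_slope y"
proof -
  define m where "m y = y * cosh y / sinh y - 1 - ln (sinh y / y)" for y :: real
  have m': "(m has_real_derivative (1 / t - t / (sinh t)\<^sup>2)) (at t)" if "t > 0" for t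
  proof -
    have "(cosh t)\<^sup>2 = (sinh t)\<^sup>2 + 1" by (simp add: cosh_square_eq)
    moreover have "sinh t > 0" using that by simp
    ultimately show ?thesis
      unfolding m_def using that
      by (auto intro!: derivative_eq_intros simp: field_simps power2_eq_square)
  qed
  have m_mono: "m u < m v" if "0 < u" "u < v" for u v
  proof (rule DERIV_pos_imp_increasing[OF that(2)])
    fix t assume t: "u \<le> t" "t \<le> v"
    have "t > 0" using t that by simp
    hence "t\<^sup>2 < (sinh t)\<^sup>2" using sinh_gt_self[of t] by (intro power_strict_mono) auto
    hence "1 / t - t / (sinh t)\<^sup>2 > 0" using \<open>t > 0\<close> by (simp add: field_simps power2_eq_square)
    thus "\<exists>d. (m has_real_derivative d) (at t) \<and> d > 0" using m'[OF \<open>t > 0\<close>] by blast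
  qed
  have m_pos: "m t > 0" if "t > 0" for t
  proof (rule strict_mono_tendsto_less[OF m_mono _ that])
    show "(m \<longlongrightarrow> 0) (at_right 0)" unfolding m_def by real_asymp
  qed
  show ?thesis
  proof (rule DERIV_pos_imp_increasing[OF assms(2)])
    fix t assume t: "x \<le> t" "t \<le> y"
    hence t0: "t > 0" "sinh t > 0" using assms by auto
    hence "(log_sinhc_slope has_real_derivative (m t / t\<^sup>2)) (at t)"
      unfolding log_sinhc_slope_def m_def
      by (auto intro!: derivative_eq_intros simp: field_simps power2_eq_square)
    moreover have "m t / t\<^sup>2 > 0" using m_pos t0 by simp
    ultimately show "\<exists>d. (log_sinhc_slope has_real_derivative d) (at t) \<and> d > 0" by blast
  qed
qed

lemma log_sinhc_slope_pos: "y > 0 \<Longrightarrow> log_sinhc_slope y > 0"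
  using strict_mono_tendsto_less log_sinhc_slope_strict_mono log_sinhc_slope_at_0 by blast

lemma continuous_on_log_sinhc_slope: "continuous_on {0<..} log_sinhc_slope"
  unfolding log_sinhc_slope_def by (intro continuous_intros) auto

text \<open>Rests on 1 - exp (-2y) = 2 exp (-y) sinh y, which turns the left side into exp y divided
  by (sinh y / y).\<close>

lemma over_one_minus_exp_eq:
  fixes y :: real
  assumes "y > 0"
  shows "2 * y / (1 - exp (- (2 * y))) = exp (y - y * log_sinhc_slope y)"
proof -
  have "exp (y - y * log_sinhc_slope y) = exp y / (sinh y / y)"
    using assms by (simp add: log_sinhc_slope_def exp_diff)
  also have "sinh y = (exp y - exp (- y)) / 2" by (simp add: sinh_field_def)
  also have "exp y / ((exp y - exp (- y)) / 2 / y) = 2 * y / ((exp y - exp (- y)) / exp y)"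
    by simp
  also have "(exp y - exp (- y)) / exp y = 1 - exp (- (2 * y))"
    by (simp add: diff_divide_distrib flip: exp_diff)
  finally show ?thesis by simp
qed

section \<open>The exponential form of the kernel and the sign of its exponent\<close>

definition barnes_slope :: "real \<Rightarrow> real \<Rightarrow> real \<Rightarrow> real \<Rightarrow> real" where
  "barnes_slope w1 w2 a x = (w1 + w2) / 2 - a
     - (w1 / 2 * log_sinhc_slope (w1 / 2 * x) + w2 / 2 * log_sinhc_slope (w2 / 2 * x))"

text \<open>\<open>over_one_minus_exp_eq\<close> is applied to both factors with y = w x / 2. So
  \<open>barnes_slope\<close> is the M of the overview, and \<open>1 / (w1 * w2)\<close> is the
  value of the kernel at 0.\<close>

lemma barnes_kernel_eq_exp:
  assumes "w1 > 0" "w2 > 0" "x > 0"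
  shows "barnes_kernel w1 w2 a x = exp (x * barnes_slope w1 w2 a x) / (w1 * w2)"
proof -
  have "barnes_kernel w1 w2 a x = exp (- a * x) *
      (2 * (w1 / 2 * x) / (1 - exp (- (2 * (w1 / 2 * x))))) *
      (2 * (w2 / 2 * x) / (1 - exp (- (2 * (w2 / 2 * x))))) / (w1 * w2)"
    using assms by (simp add: barnes_kernel_def barnes_laplace_def power2_eq_square)
  also have "\<dots> = exp (x * barnes_slope w1 w2 a x) / (w1 * w2)"
    using assms by (subst (1 2) over_one_minus_exp_eq)
      (simp_all add: barnes_slope_def algebra_simps flip: exp_add)
  finally show ?thesis .
qed

lemma barnes_slope_strict_antimono:
  assumes "w1 > 0" "w2 > 0" "0 < x" "x < y"
  shows "barnes_slope w1 w2 a y < barnes_slope w1 w2 a x"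
proof -
  have "w * log_sinhc_slope (w * x) < w * log_sinhc_slope (w * y)" if "w > 0" for w
    using that assms by (intro mult_strict_left_mono log_sinhc_slope_strict_mono) auto
  from this[of "w1 / 2"] this[of "w2 / 2"] show ?thesis
    using assms(1,2) unfolding barnes_slope_def by linarith
qed

lemma barnes_slope_at_0:
  assumes "w1 > 0" "w2 > 0"
  shows "(barnes_slope w1 w2 a \<longlongrightarrow> (w1 + w2) / 2 - a) (at_right 0)"
proof -
  have "((\<lambda>x. log_sinhc_slope (w / 2 * x)) \<longlongrightarrow> 0) (at_right 0)" if "w > 0" for w
    by (rule filterlim_compose[OF log_sinhc_slope_at_0]) (use that in real_asymp)
  hence "(barnes_slope w1 w2 a \<longlongrightarrow> (w1 + w2) / 2 - a - (w1 / 2 * 0 + w2 / 2 * 0)) (at_right 0)"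
    unfolding barnes_slope_def using assms by (intro tendsto_intros) auto
  thus ?thesis by simp
qed

lemma barnes_slope_at_top:
  assumes "w1 > 0" "w2 > 0"
  shows "(barnes_slope w1 w2 a \<longlongrightarrow> - a) at_top"
proof -
  have "((\<lambda>x. log_sinhc_slope (w / 2 * x)) \<longlongrightarrow> 1) at_top" if "w > 0" for w
    by (rule filterlim_compose[OF log_sinhc_slope_at_top]) (use that in real_asymp)
  hence "(barnes_slope w1 w2 a \<longlongrightarrow> (w1 + w2) / 2 - a - (w1 / 2 * 1 + w2 / 2 * 1)) at_top"
    unfolding barnes_slope_def using assms by (intro tendsto_intros) auto
  thus ?thesis by (simp add: field_simps)
qed

lemma barnes_slope_neg:
  assumes "w1 > 0" "w2 > 0" "a \<ge> (w1 + w2) / 2" "x > 0"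
  shows "barnes_slope w1 w2 a x < 0"
proof -
  have "w / 2 * log_sinhc_slope (w / 2 * x) > 0" if "w > 0" for w
    using that assms(4) by (intro mult_pos_pos log_sinhc_slope_pos) auto
  from this[OF assms(1)] this[OF assms(2)] show ?thesis
    using assms(3) unfolding barnes_slope_def by linarith
qed

lemma barnes_slope_root:
  assumes "w1 > 0" "w2 > 0" "0 < a" "a < (w1 + w2) / 2"
  obtains x0 where "x0 > 0" "barnes_slope w1 w2 a x0 = 0"
proof -
  let ?M = "barnes_slope w1 w2 a"
  have "eventually (\<lambda>x. ?M x > 0) (at_right 0)"
    using assms by (intro order_tendstoD[OF barnes_slope_at_0]) auto
  then obtain b where b: "b > 0" "\<And>x. 0 < x \<Longrightarrow> x < b \<Longrightarrow> ?M x > 0"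
    by (auto simp: eventually_at_right_field)
  have "eventually (\<lambda>x. ?M x < 0) at_top"
    using assms by (intro order_tendstoD[OF barnes_slope_at_top]) auto
  then obtain B where B: "\<And>x. x \<ge> B \<Longrightarrow> ?M x < 0"
    by (auto simp: eventually_at_top_linorder)
  \<comment> \<open>The left end lies inside (0, b), where the slope is positive; the maximum keeps
    the ends in order and reaches the region of negative slope.\<close>
  have cont: "continuous_on {b / 2..max b B} ?M"
    unfolding barnes_slope_def using b(1) assms
    by (intro continuous_intros continuous_on_compose2[OF continuous_on_log_sinhc_slope]) auto
  have "\<exists>x\<ge>b / 2. x \<le> max b B \<and> ?M x = 0"
    by (rule IVT2'[OF _ _ _ cont]) (use b(1) B[of "max b B"] less_imp_le[OF b(2)[of "b / 2"]] in auto)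
  then obtain x where "x \<ge> b / 2" "?M x = 0" by blast
  thus ?thesis using that[of x] b(1) by auto
qed

lemma barnes_kernel_less_iff:
  assumes "w1 > 0" "w2 > 0" "x > 0"
  shows "barnes_kernel w1 w2 a x < 1 / (w1 * w2) \<longleftrightarrow> barnes_slope w1 w2 a x < 0"
    and "barnes_kernel w1 w2 a x > 1 / (w1 * w2) \<longleftrightarrow> barnes_slope w1 w2 a x > 0"
proof -
  have "w1 * w2 > 0" using assms by simp
  thus "barnes_kernel w1 w2 a x < 1 / (w1 * w2) \<longleftrightarrow> barnes_slope w1 w2 a x < 0"
    "barnes_kernel w1 w2 a x > 1 / (w1 * w2) \<longleftrightarrow> barnes_slope w1 w2 a x > 0"
    using assms by (simp_all add: barnes_kernel_eq_exp divide_less_cancel mult_less_0_iff zero_less_mult_iff)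
qed

lemma barnes_kernel_at_0:
  assumes "w1 > 0" "w2 > 0"
  shows "(barnes_kernel w1 w2 a \<longlongrightarrow> 1 / (w1 * w2)) (at_right 0)"
proof -
  have "((\<lambda>x. exp (x * barnes_slope w1 w2 a x) / (w1 * w2)) \<longlongrightarrow> exp (0 * ((w1 + w2) / 2 - a)) / (w1 * w2)) (at_right 0)"
    using assms by (intro tendsto_intros barnes_slope_at_0) auto
  moreover have "eventually (\<lambda>x. exp (x * barnes_slope w1 w2 a x) / (w1 * w2) = barnes_kernel w1 w2 a x) (at_right 0)"
    using eventually_at_right_less[of 0] by eventually_elim (use assms in \<open>simp add: barnes_kernel_eq_exp\<close>)
  ultimately show ?thesis by (simp add: Lim_transform_eventually)
qed

lemma AE_pos_lborel_neq: "AE x in pos_lborel. x \<noteq> c"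
proof -
  have "AE x in lborel. x \<noteq> c" by (rule AE_lborel_singleton)
  thus ?thesis by (subst AE_restrict_space_iff) (auto elim: eventually_mono)
qed

text \<open>One exceptional point \<open>c\<close> is allowed because the integrands below vanish
  where the kernel crosses its value at 0. If the integral were zero, \<open>f\<close> would vanish
  almost everywhere and (0,1) would be a null set.\<close>

lemma integral_pos_lborel_neg:
  fixes f :: "real \<Rightarrow> real"
  assumes int: "integrable pos_lborel f" and neg: "\<And>x. x > 0 \<Longrightarrow> x \<noteq> c \<Longrightarrow> f x < 0"
  shows "(\<integral>x. f x \<partial>pos_lborel) < 0"
proof -
  have AE_neg: "AE x in pos_lborel. f x < 0"
    using AE_pos_lborel_neq[of c] AE_space by eventually_elim (use neg in auto)
  have int': "integrable pos_lborel (\<lambda>x. - f x)" using int by simp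
  have nonneg: "AE x in pos_lborel. 0 \<le> - f x" using AE_neg by eventually_elim auto
  have "(\<integral>x. - f x \<partial>pos_lborel) \<noteq> 0"
  proof
    assume "(\<integral>x. - f x \<partial>pos_lborel) = 0"
    hence "AE x in pos_lborel. - f x = 0"
      using integral_nonneg_eq_0_iff_AE[OF int' nonneg] by simp
    hence "AE x in pos_lborel. False" using AE_neg by eventually_elim auto
    hence "AE x in lborel. x \<notin> {0<..<1::real}"
      by (subst (asm) AE_restrict_space_iff) (auto elim: eventually_mono)
    hence "{0<..<1::real} \<in> null_sets lborel"
      by (subst AE_iff_null_sets) auto
    thus False by auto
  qed
  moreover have "(\<integral>x. - f x \<partial>pos_lborel) \<ge> 0" using nonneg by (rule integral_nonneg_AE)
  ultimately show ?thesis by simp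
qed

section \<open>The zeros between 1 and 2\<close>

lemma zorder_eq_1_if_deriv_nonzero:
  assumes "f analytic_on {z}" "f z = 0" "(f has_field_derivative d) (at z)" "d \<noteq> 0"
  shows "zorder f z = 1"
  using assms by (intro zorder_zero_eqI') (auto simp: DERIV_imp_deriv)

lemma rGamma_nonzero: "Re s > 0 \<Longrightarrow> rGamma s \<noteq> 0"
  by (auto simp: rGamma_eq_zero_iff elim!: nonpos_Ints_cases)

locale barnes_parameters =
  fixes w1 w2 a :: real
  assumes a_pos: "a > 0" and w1_pos: "w1 > 0" and w2_pos: "w2 > 0"
begin

abbreviation "kernel_at_0 \<equiv> 1 / (w1 * w2)"

definition reduced :: "real \<Rightarrow> real" where
  "reduced x = barnes_kernel w1 w2 a x - kernel_at_0"

text \<open>On the real axis everything is expressed through u = \<sigma> - 2, so the interval (1,2)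
  becomes (-1,0).\<close>

definition reduced_mellin :: "real \<Rightarrow> real" where
  "reduced_mellin u = (\<integral>x. x powr (u - 1) * reduced x \<partial>pos_lborel)"

lemma mellin_reduced_of_real: "mellin reduced (of_real u) = of_real (reduced_mellin u)"
  unfolding reduced_mellin_def by (rule mellin_of_real)

lemma expansion_obtain:
  obtains p where "mellin_continuation (barnes_kernel w1 w2 a) p" "p 0 = kernel_at_0"
proof -
  obtain p where p: "mellin_continuation (barnes_kernel w1 w2 a) p"
    by (rule barnes_kernel_mellin_continuation[OF a_pos w1_pos w2_pos])
  interpret mellin_continuation "barnes_kernel w1 w2 a" p by fact
  have "p 0 = kernel_at_0"
    using tendsto_unique[OF _ tendsto_coeff_0 barnes_kernel_at_0[OF w1_pos w2_pos]] by simp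
  thus ?thesis using p that by blast
qed

lemma reduced_convergent:
  assumes "-1 < u" "u < 0"
  shows "mellin_convergent reduced u"
proof -
  obtain p where p: "mellin_continuation (barnes_kernel w1 w2 a) p" "p 0 = kernel_at_0"
    by (rule expansion_obtain)
  interpret mellin_continuation "barnes_kernel w1 w2 a" p by fact
  show ?thesis using convergent_minus_const[OF assms] by (simp add: p(2) reduced_def[abs_def])
qed

lemma reduced_holomorphic: "mellin reduced holomorphic_on {s. -1 < Re s \<and> Re s < 0}"
  using mellin_holomorphic[of "{-1<..<0}" reduced] reduced_convergent by auto

lemma open_strip: "open {s. c < Re s \<and> Re s < d}"
  by (intro open_Collect_conj open_halfspace_Re_gt open_halfspace_Re_lt)

text \<open>The candidate \<open>rGamma s * continuation (s - 2)\<close> equals the series for Re s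
  > 2 and the stated product in the strip. It is analytic in both regions, so making it nicely
  meromorphic by \<open>remove_sings\<close> changes no value there.\<close>

lemma barnes_zeta2_eq:
  assumes "1 < Re s" "Re s < 2"
  shows "barnes_zeta2 w1 w2 a s = rGamma s * mellin reduced (s - 2)"
proof -
  obtain p where p: "mellin_continuation (barnes_kernel w1 w2 a) p" "p 0 = kernel_at_0"
    by (rule expansion_obtain)
  interpret mellin_continuation "barnes_kernel w1 w2 a" p by fact
  define Z where "Z s = rGamma s * continuation (s - 2)" for s
  have "(\<lambda>s. continuation (s - 2)) meromorphic_on UNIV"
    by (rule meromorphic_on_compose[OF continuation_meromorphic]) (auto intro!: analytic_intros)
  hence Z_mero: "Z meromorphic_on UNIV"
    unfolding Z_def by (intro meromorphic_on_mult analytic_on_imp_meromorphic_on[OF analytic_rGamma])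
  have Z_strip: "Z s = rGamma s * mellin reduced (s - 2)" if "1 < Re s" "Re s < 2" for s
    using continuation_eq_mellin_minus_const[of "s - 2"] that
    by (simp add: Z_def p(2) reduced_def[abs_def])
  have Z_right: "Z s = barnes_zeta2_series w1 w2 a s" if "Re s > 2" for s
    using continuation_eq_mellin[of "s - 2"] that a_pos w1_pos w2_pos
    by (simp add: Z_def barnes_zeta2_series_eq_mellin mellin_barnes_kernel)
  have "barnes_zeta2 w1 w2 a = remove_sings Z"
  proof (rule barnes_zeta2_eqI)
    show "remove_sings Z nicely_meromorphic_on UNIV"
      using Z_mero by (rule remove_sings_nicely_meromorphic)
    fix s assume s: "Re s > 2"
    have "mellin (barnes_laplace w1 w2 a) holomorphic_on {s. Re s \<in> {2<..}}"
      by (intro mellin_holomorphic mellin_convergent_barnes_laplace a_pos w1_pos w2_pos) auto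
    hence "(\<lambda>s. rGamma s * mellin (barnes_laplace w1 w2 a) s) holomorphic_on {s. Re s > 2}"
      by (intro holomorphic_intros) auto
    hence "Z holomorphic_on {s. Re s > 2}"
      by (rule holomorphic_transform) (use Z_right a_pos w1_pos w2_pos in \<open>auto simp: barnes_zeta2_series_eq_mellin\<close>)
    hence "Z analytic_on {s}"
      using s open_halfspace_Re_gt[of 2] analytic_at by blast
    thus "remove_sings Z s = barnes_zeta2_series w1 w2 a s"
      using Z_right[OF s] by simp
  qed
  moreover have "Z analytic_on {s}"
  proof -
    have "(\<lambda>s. rGamma s * mellin reduced (s - 2)) holomorphic_on {s. 1 < Re s \<and> Re s < 2}"
      by (intro holomorphic_intros holomorphic_on_compose_gen[OF _ reduced_holomorphic, unfolded o_def]) auto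
    hence "Z holomorphic_on {s. 1 < Re s \<and> Re s < 2}"
      by (rule holomorphic_transform) (use Z_strip in auto)
    thus ?thesis using assms open_strip[of 1 2] analytic_at by blast
  qed
  ultimately show ?thesis using Z_strip[OF assms] by simp
qed

lemma barnes_zeta2_zero_iff:
  assumes "1 < \<sigma>" "\<sigma> < 2"
  shows "barnes_zeta2 w1 w2 a (of_real \<sigma>) = 0 \<longleftrightarrow> reduced_mellin (\<sigma> - 2) = 0"
proof -
  have "rGamma (complex_of_real \<sigma>) \<noteq> 0"
    using assms by (intro rGamma_nonzero) auto
  thus ?thesis using barnes_zeta2_eq[of "of_real \<sigma>"] assms mellin_reduced_of_real[of "\<sigma> - 2"] by simp
qed

lemma reduced_integrable:
  "-1 < u \<Longrightarrow> u < 0 \<Longrightarrow> integrable pos_lborel (\<lambda>x. x powr (u - 1) * reduced x)"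
  using reduced_convergent by (simp add: mellin_convergent_def)

lemma reduced_mellin_neg:
  assumes "a \<ge> (w1 + w2) / 2" "-1 < u" "u < 0"
  shows "reduced_mellin u < 0"
  unfolding reduced_mellin_def
proof (rule integral_pos_lborel_neg[OF reduced_integrable[OF assms(2,3)]])
  fix x :: real assume "x > 0"
  thus "x powr (u - 1) * reduced x < 0"
    using barnes_slope_neg[of w1 w2 a x] assms(1) w1_pos w2_pos barnes_kernel_less_iff(1)[of w1 w2 x a]
    by (simp add: reduced_def mult_pos_neg)
qed

lemma reduced_crossing:
  assumes "a < (w1 + w2) / 2"
  obtains x0 where "x0 > 0" "\<And>x. 0 < x \<Longrightarrow> x < x0 \<Longrightarrow> reduced x > 0" "\<And>x. x > x0 \<Longrightarrow> reduced x < 0"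
proof -
  obtain x0 where x0: "x0 > 0" "barnes_slope w1 w2 a x0 = 0"
    using barnes_slope_root[OF w1_pos w2_pos a_pos assms] .
  show ?thesis
  proof (rule that[OF x0(1)])
    fix x assume "0 < x" "x < x0"
    thus "reduced x > 0"
      using barnes_slope_strict_antimono[OF w1_pos w2_pos, of x x0 a] x0 w1_pos w2_pos
        barnes_kernel_less_iff(2)[of w1 w2 x a] by (simp add: reduced_def)
  next
    fix x assume "x > x0"
    thus "reduced x < 0"
      using barnes_slope_strict_antimono[OF w1_pos w2_pos, of x0 x a] x0 w1_pos w2_pos
        barnes_kernel_less_iff(1)[of w1 w2 x a] by (simp add: reduced_def)
  qed
qed

text \<open>A finite-difference form of the monotonicity argument:
  \<open>x0 powr (- u) * reduced_mellin u\<close> strictly decreases in \<open>u\<close>, so it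
  cannot vanish at two points.\<close>

lemma reduced_mellin_zero_unique:
  assumes "a < (w1 + w2) / 2" "-1 < u" "u < v" "v < 0" "reduced_mellin u = 0"
  shows "reduced_mellin v \<noteq> 0"
proof
  assume v: "reduced_mellin v = 0"
  obtain x0 where x0: "x0 > 0" "\<And>x. 0 < x \<Longrightarrow> x < x0 \<Longrightarrow> reduced x > 0" "\<And>x. x > x0 \<Longrightarrow> reduced x < 0"
    by (rule reduced_crossing[OF assms(1)]) (rule that)
  \<comment> \<open>The weights are rescaled to \<open>(x / x0) powr v\<close> and \<open>(x / x0) powr u\<close>, whose difference changes sign at \<open>x0\<close>, just as \<open>reduced\<close> does.\<close>
  let ?f = "\<lambda>x. x0 powr (- v) * (x powr (v - 1) * reduced x) - x0 powr (- u) * (x powr (u - 1) * reduced x)"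
  have int: "integrable pos_lborel ?f"
    using assms by (intro Bochner_Integration.integrable_diff integrable_mult_right reduced_integrable) auto
  have "(\<integral>x. ?f x \<partial>pos_lborel) = x0 powr (- v) * reduced_mellin v - x0 powr (- u) * reduced_mellin u"
    unfolding reduced_mellin_def using assms
    by (subst Bochner_Integration.integral_diff) (auto intro!: integrable_mult_right reduced_integrable)
  moreover have "(\<integral>x. ?f x \<partial>pos_lborel) < 0"
  proof (rule integral_pos_lborel_neg[OF int, of x0])
    fix x :: real assume x: "x > 0" "x \<noteq> x0"
    have eq: "?f x = ((x / x0) powr v - (x / x0) powr u) * (reduced x / x)"
      using x x0(1) by (simp add: powr_diff powr_minus powr_divide field_simps)
    consider "x < x0" | "x > x0" using x(2) by linarith
    hence "((x / x0) powr v - (x / x0) powr u) * reduced x < 0"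
    proof cases
      case 1
      hence "(x / x0) powr v < (x / x0) powr u"
        using x(1) x0(1) assms(3) by (intro powr_less_mono') auto
      thus ?thesis using x0(2)[OF x(1) 1] by (intro mult_neg_pos) auto
    next
      case 2
      hence "(x / x0) powr u < (x / x0) powr v"
        using x(1) x0(1) assms(3) by (intro powr_less_mono) auto
      thus ?thesis using x0(3)[OF 2] by (intro mult_pos_neg) auto
    qed
    thus "?f x < 0" unfolding eq using x(1) by (simp add: divide_neg_pos)
  qed
  ultimately show False using assms(5) v by simp
qed

text \<open>Because \<open>reduced_mellin u\<close> vanishes, \<open>ln x\<close> may be replaced by
  \<open>ln x - ln x0\<close> without changing the integral. That factor changes sign at
  \<open>x0\<close> in the direction opposite to \<open>reduced\<close>, so the integrand is
  negative away from \<open>x0\<close>.\<close>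

lemma mellin_ln_reduced_nonzero:
  assumes "a < (w1 + w2) / 2" "-1 < u" "u < 0" "reduced_mellin u = 0"
  shows "mellin (\<lambda>x. ln x * reduced x) (of_real u) \<noteq> 0"
proof -
  obtain x0 where x0: "x0 > 0" "\<And>x. 0 < x \<Longrightarrow> x < x0 \<Longrightarrow> reduced x > 0" "\<And>x. x > x0 \<Longrightarrow> reduced x < 0"
    by (rule reduced_crossing[OF assms(1)]) (rule that)
  have "mellin_convergent (\<lambda>x. ln x * reduced x) u"
    by (rule mellin_convergent_ln[of "{-1<..<0}"]) (use assms reduced_convergent in auto)
  hence int1: "integrable pos_lborel (\<lambda>x. x powr (u - 1) * (ln x * reduced x))"
    by (simp add: mellin_convergent_def)
  note int2 = reduced_integrable[OF assms(2,3)]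
  let ?f = "\<lambda>x. x powr (u - 1) * (ln x * reduced x) - ln x0 * (x powr (u - 1) * reduced x)"
  have "(\<integral>x. ?f x \<partial>pos_lborel) < 0"
  proof (rule integral_pos_lborel_neg[of _ x0])
    show "integrable pos_lborel ?f"
      by (intro Bochner_Integration.integrable_diff integrable_mult_right int1 int2)
    fix x :: real assume x: "x > 0" "x \<noteq> x0"
    have eq: "?f x = x powr (u - 1) * ((ln x - ln x0) * reduced x)"
      by (simp add: algebra_simps)
    consider "x < x0" | "x > x0" using x(2) by linarith
    hence "(ln x - ln x0) * reduced x < 0"
    proof cases
      case 1
      thus ?thesis using x0(2)[OF x(1) 1] x(1) x0(1) by (intro mult_neg_pos) auto
    next
      case 2
      thus ?thesis using x0(3)[OF 2] x(1) x0(1) by (intro mult_pos_neg) auto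
    qed
    hence "x powr (u - 1) * ((ln x - ln x0) * reduced x) < 0"
      by (rule mult_pos_neg[rotated]) (use x(1) in simp)
    thus "?f x < 0" unfolding eq .
  qed
  also have "(\<integral>x. ?f x \<partial>pos_lborel) = (\<integral>x. x powr (u - 1) * (ln x * reduced x) \<partial>pos_lborel) - ln x0 * reduced_mellin u"
    unfolding reduced_mellin_def using int1 int2
    by (subst Bochner_Integration.integral_diff) (auto intro!: integrable_mult_right)
  finally show ?thesis using assms(4) by (simp add: mellin_of_real)
qed

lemma reduced_mellin_root:
  assumes "a < (w1 + w2) / 2"
  shows "\<exists>u. -1 < u \<and> u < 0 \<and> reduced_mellin u = 0"
proof -
  obtain p where p: "mellin_continuation (barnes_kernel w1 w2 a) p" "p 0 = kernel_at_0"
    by (rule expansion_obtain)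
  interpret mellin_continuation "barnes_kernel w1 w2 a" p by fact
  have p0: "p 0 > 0" using p(2) w1_pos w2_pos by simp
  have p1: "p 1 > 0"
  proof -
    \<comment> \<open>Here \<open>p 1\<close> is the limit of (P(x) - P(0)) / x, and exp t - 1 >= t
      bounds this quotient below by P(0) times the slope, whose limit at 0 is known.\<close>
    have "kernel_at_0 * ((w1 + w2) / 2 - a) \<le> p 1"
    proof (rule tendsto_le[OF _ tendsto_coeff_1])
      show "((\<lambda>x. kernel_at_0 * barnes_slope w1 w2 a x) \<longlongrightarrow> kernel_at_0 * ((w1 + w2) / 2 - a)) (at_right 0)"
        by (intro tendsto_intros barnes_slope_at_0 w1_pos w2_pos)
      show "eventually (\<lambda>x. kernel_at_0 * barnes_slope w1 w2 a x \<le> (barnes_kernel w1 w2 a x - p 0) / x) (at_right 0)"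
        using eventually_at_right_less[of 0]
      proof eventually_elim
        case (elim x)
        have "kernel_at_0 * (x * barnes_slope w1 w2 a x) \<le> kernel_at_0 * (exp (x * barnes_slope w1 w2 a x) - 1)"
        proof (rule mult_left_mono)
          show "x * barnes_slope w1 w2 a x \<le> exp (x * barnes_slope w1 w2 a x) - 1"
            using exp_ge_add_one_self[of "x * barnes_slope w1 w2 a x"] by linarith
        qed (use w1_pos w2_pos in auto)
        also have "\<dots> = barnes_kernel w1 w2 a x - p 0"
          using elim w1_pos w2_pos by (simp add: barnes_kernel_eq_exp p(2) diff_divide_distrib)
        finally show ?case using elim by (simp add: field_simps)
      qed
    qed auto
    moreover have "kernel_at_0 * ((w1 + w2) / 2 - a) > 0"
      using assms w1_pos w2_pos by (intro mult_pos_pos) auto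
    ultimately show ?thesis by linarith
  qed
  \<comment> \<open>\<open>R N\<close> is continuous on \<open>{- real N<..}\<close>:
    \<open>R 1\<close> extends past the end 0 of the interval, and \<open>R 2\<close> is continuous
    at the end -1.\<close>
  define R where "R N u = Re (mellin (mellin_regular (barnes_kernel w1 w2 a) p N) (of_real u))" for N u
  have R_cont: "continuous_on {- real N<..} (R N)" for N
    unfolding R_def
    by (intro continuous_intros continuous_on_compose2[OF holomorphic_on_imp_continuous_on[OF regular_holomorphic]]) auto
  have eq: "complex_of_real (reduced_mellin u) = mellin_cont (barnes_kernel w1 w2 a) p N (of_real u)"
    if "-1 < u" "u < 0" "N \<ge> 1" for u N
  proof -
    have "complex_of_real (reduced_mellin u) = continuation (of_real u)"
      using that continuation_eq_mellin_minus_const[of "of_real u"]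
      by (simp add: p(2) reduced_def[abs_def] flip: mellin_reduced_of_real)
    also have "\<dots> = mellin_cont (barnes_kernel w1 w2 a) p N (of_real u)"
      using that by (intro continuation_eq) auto
    finally show ?thesis .
  qed
  \<comment> \<open>One removed term exposes the pole at 0, and multiplying by \<open>u\<close>
    cancels it; the value at 0 is the residue \<open>p 0\<close>.\<close>
  have eq1: "u * reduced_mellin u = p 0 + u * R 1 u" if "-1 < u" "u < 0" for u
  proof -
    have "reduced_mellin u = p 0 / u + R 1 u"
      using arg_cong[OF eq[OF that, of 1], of Re] by (simp add: mellin_cont_def R_def Re_divide_of_real)
    thus ?thesis using that by (simp add: field_simps)
  qed
  \<comment> \<open>The pole at -1 appears only with the second term removed; the value of the right
    side at -1 is the residue \<open>p 1\<close>.\<close>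
  have eq2: "(u + 1) * reduced_mellin u = p 1 + (u + 1) * (p 0 / u + R 2 u)" if "-1 < u" "u < 0" for u
  proof -
    have "complex_of_real u + 1 = of_real (u + 1)" by simp
    hence "reduced_mellin u = p 0 / u + p 1 / (u + 1) + R 2 u"
      using arg_cong[OF eq[OF that, of 2], of Re]
      by (simp add: mellin_cont_def R_def Re_divide_of_real numeral_2_eq_2 del: of_real_add)
    moreover have "(u + 1) * (p 1 / (u + 1)) = p 1" using that by simp
    ultimately show ?thesis by (simp only: distrib_left add_ac)
  qed
  \<comment> \<open>Both residues are positive, but \<open>u\<close> is negative left of 0 while
    \<open>u + 1\<close> is positive right of -1; hence the opposite signs at the two ends.\<close>
  have neg: "reduced_mellin u < 0" if "-1 < u" "u < 0" "p 0 + u * R 1 u > 0" for u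
  proof -
    have "u * reduced_mellin u > 0" using eq1 that by simp
    thus ?thesis using that(2) by (simp add: zero_less_mult_iff)
  qed
  have pos: "reduced_mellin u > 0" if "-1 < u" "u < 0" "p 1 + (u + 1) * (p 0 / u + R 2 u) > 0" for u
  proof -
    have "(u + 1) * reduced_mellin u > 0" using eq2 that by simp
    thus ?thesis using that(1) by (simp add: zero_less_mult_iff)
  qed
  have "isCont (\<lambda>u. p 0 + u * R 1 u) 0"
    by (intro continuous_intros continuous_on_interior[OF R_cont]) (auto simp: interior_open)
  hence "((\<lambda>u. p 0 + u * R 1 u) \<longlongrightarrow> p 0 + 0 * R 1 0) (at 0)"
    by (rule isContD)
  hence "eventually (\<lambda>u. p 0 + u * R 1 u > 0) (at 0)"
    using p0 by (intro order_tendstoD) auto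
  hence "eventually (\<lambda>u. p 0 + u * R 1 u > 0) (at_left 0)"
    by (rule filter_leD[OF at_le, rotated]) auto
  moreover have "eventually (\<lambda>u::real. u \<in> {-1<..<0}) (at_left 0)"
    by (rule eventually_at_left_real) auto
  ultimately have "eventually (\<lambda>u. -1 < u \<and> u < 0 \<and> reduced_mellin u < 0) (at_left 0)"
    by eventually_elim (use neg in auto)
  then obtain v where v: "-1 < v" "v < 0" "reduced_mellin v < 0"
    using eventually_happens[of _ "at_left (0::real)"] by auto
  have "isCont (\<lambda>u. p 1 + (u + 1) * (p 0 / u + R 2 u)) (-1)"
    by (intro continuous_intros continuous_on_interior[OF R_cont]) (auto simp: interior_open)
  hence "((\<lambda>u. p 1 + (u + 1) * (p 0 / u + R 2 u)) \<longlongrightarrow> p 1 + (-1 + 1) * (p 0 / (-1) + R 2 (-1))) (at (-1))"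
    by (rule isContD)
  hence "eventually (\<lambda>u. p 1 + (u + 1) * (p 0 / u + R 2 u) > 0) (at (-1))"
    using p1 by (intro order_tendstoD) auto
  hence "eventually (\<lambda>u. p 1 + (u + 1) * (p 0 / u + R 2 u) > 0) (at_right (-1))"
    by (rule filter_leD[OF at_le, rotated]) auto
  \<comment> \<open>Restricting to points left of \<open>v\<close> puts the positive value before
    the negative one, as the intermediate value theorem requires.\<close>
  moreover have "eventually (\<lambda>u::real. u \<in> {-1<..<v}) (at_right (-1))"
    by (rule eventually_at_right_real) (use v in auto)
  ultimately have "eventually (\<lambda>u. -1 < u \<and> u < v \<and> reduced_mellin u > 0) (at_right (-1))"
    by eventually_elim (use pos v in auto)
  then obtain u where u: "-1 < u" "u < v" "reduced_mellin u > 0"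
    using eventually_happens[of _ "at_right (-1::real)"] by auto
  have "continuous_on {u..v} (\<lambda>t. Re (mellin reduced (of_real t)))"
    by (intro continuous_intros continuous_on_compose2[OF holomorphic_on_imp_continuous_on[OF reduced_holomorphic]])
       (use u v in auto)
  hence "continuous_on {u..v} reduced_mellin"
    by (simp add: mellin_reduced_of_real)
  hence "\<exists>t\<ge>u. t \<le> v \<and> reduced_mellin t = 0"
    using u v by (intro IVT2') auto
  then obtain t where "t \<ge> u" "t \<le> v" "reduced_mellin t = 0" by blast
  thus ?thesis using u v by (intro exI[of _ t]) auto
qed

text \<open>At a zero the product rule leaves only \<open>rGamma\<close> times the derivative of the
  Mellin transform, and both factors are nonzero.\<close>

lemma barnes_zeta2_simple_zero:
  assumes "a < (w1 + w2) / 2" "1 < \<sigma>" "\<sigma> < 2" "barnes_zeta2 w1 w2 a (of_real \<sigma>) = 0"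
  shows "zorder (barnes_zeta2 w1 w2 a) (of_real \<sigma>) = 1"
proof -
  let ?S = "{s. 1 < Re s \<and> Re s < 2}"
  let ?g = "\<lambda>s. rGamma s * mellin reduced (s - 2)"
  have I0: "reduced_mellin (\<sigma> - 2) = 0" using barnes_zeta2_zero_iff assms by blast
  have M0: "mellin reduced (of_real \<sigma> - 2) = 0"
    using mellin_reduced_of_real[of "\<sigma> - 2"] I0 by simp
  have rG: "rGamma (complex_of_real \<sigma>) \<noteq> 0"
    using assms by (intro rGamma_nonzero) auto
  let ?D = "mellin (\<lambda>x. ln x * reduced x) (of_real \<sigma> - 2)"
  have "(mellin reduced has_field_derivative ?D) (at (of_real \<sigma> - 2))"
    by (rule mellin_has_field_derivative[of "{-1<..<0}"]) (use assms reduced_convergent in auto)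
  hence "((\<lambda>s. mellin reduced (s - 2)) has_field_derivative ?D) (at (of_real \<sigma>))"
    using DERIV_chain2[of "mellin reduced" ?D "\<lambda>s. s - 2" "of_real \<sigma>" 1 UNIV]
      DERIV_diff[OF DERIV_ident DERIV_const[of "2::complex"]] by simp
  \<comment> \<open>The term containing the derivative of \<open>rGamma\<close> drops out because of
    \<open>M0\<close>.\<close>
  hence "(?g has_field_derivative rGamma (of_real \<sigma>) * ?D) (at (of_real \<sigma>))"
    by (auto intro!: derivative_eq_intros simp: M0)
  hence deriv: "(barnes_zeta2 w1 w2 a has_field_derivative rGamma (of_real \<sigma>) * ?D) (at (of_real \<sigma>))"
    by (rule has_field_derivative_transform_within_open[OF _ open_strip[of 1 2]])
       (use assms barnes_zeta2_eq in auto)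
  have "?g holomorphic_on ?S"
    by (intro holomorphic_intros holomorphic_on_compose_gen[OF _ reduced_holomorphic, unfolded o_def]) auto
  hence "barnes_zeta2 w1 w2 a holomorphic_on ?S"
    by (rule holomorphic_transform) (use barnes_zeta2_eq in auto)
  hence "barnes_zeta2 w1 w2 a analytic_on {of_real \<sigma>}"
    using assms open_strip[of 1 2] analytic_at by force
  moreover have "?D \<noteq> 0"
    using mellin_ln_reduced_nonzero[of "\<sigma> - 2"] assms I0 by simp
  hence "rGamma (of_real \<sigma>) * ?D \<noteq> 0"
    using rG by simp
  ultimately show ?thesis
    by (intro zorder_eq_1_if_deriv_nonzero[OF _ assms(4) deriv])
qed

end

theorem theorem1p8:
  fixes a w1 w2 :: real
  assumes "a > 0" and "w1 > 0" and "w2 > 0"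
  shows "((\<exists>\<sigma>::real. 1 < \<sigma> \<and> \<sigma> < 2 \<and> barnes_zeta2 w1 w2 a (complex_of_real \<sigma>) = 0)
            \<longleftrightarrow> 0 < a \<and> a < (w1 + w2) / 2)
         \<and> (0 < a \<and> a < (w1 + w2) / 2 \<longrightarrow>
             (\<exists>!\<sigma>::real. 1 < \<sigma> \<and> \<sigma> < 2 \<and> barnes_zeta2 w1 w2 a (complex_of_real \<sigma>) = 0) \<and>
             (\<forall>\<sigma>::real. 1 < \<sigma> \<and> \<sigma> < 2 \<and> barnes_zeta2 w1 w2 a (complex_of_real \<sigma>) = 0 \<longrightarrow>
                zorder (barnes_zeta2 w1 w2 a) (complex_of_real \<sigma>) = 1))"
proof -
  interpret barnes_parameters w1 w2 a by unfold_locales fact+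
  let ?Z = "\<lambda>\<sigma>::real. 1 < \<sigma> \<and> \<sigma> < 2 \<and> barnes_zeta2 w1 w2 a (complex_of_real \<sigma>) = 0"
  have no_zero: "a < (w1 + w2) / 2" if "?Z \<sigma>" for \<sigma>
    using reduced_mellin_neg[of "\<sigma> - 2"] barnes_zeta2_zero_iff[of \<sigma>] that by force
  have zero: "\<exists>\<sigma>. ?Z \<sigma>" if small: "a < (w1 + w2) / 2"
  proof -
    obtain u where u: "-1 < u" "u < 0" "reduced_mellin u = 0"
      using reduced_mellin_root[OF small] by blast
    hence "?Z (u + 2)" using barnes_zeta2_zero_iff[of "u + 2"] by simp
    thus ?thesis by blast
  qed
  have unique: "\<sigma> = \<tau>" if small: "a < (w1 + w2) / 2" and z: "?Z \<sigma>" "?Z \<tau>" for \<sigma> \<tau>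
  proof -
    have I: "reduced_mellin (\<sigma> - 2) = 0" "reduced_mellin (\<tau> - 2) = 0"
      using z barnes_zeta2_zero_iff by blast+
    show ?thesis
      using reduced_mellin_zero_unique[OF small, of "\<sigma> - 2" "\<tau> - 2"] I z
        reduced_mellin_zero_unique[OF small, of "\<tau> - 2" "\<sigma> - 2"]
      by (cases \<sigma> \<tau> rule: linorder_cases) auto
  qed
  show ?thesis
    using no_zero zero unique barnes_zeta2_simple_zero assms(1) by blast
qed

end
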